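(* Let $A$ be an infinite and coinfinite subset of $\mathbb{N}$. Then there is a sequence $B_0,B_1,B_2,\ldots$ of subsets of $\mathbb{N}$ such that every $B_k$ is finite-one equivalent to $A$, $A$ is one-one reducible to every $B_k$, and at least one of the following holds: (i) the sets $B_0,B_1,B_2,\ldots$ form an antichain in the one-one degrees, that is, for all $i\neq j$, $B_i$ is not one-one reducible to $B_j$; or (ii) $A$ is in the greatest one-one degree of its many-one degree and all $B_k$ are one-one equivalent to $A$.
   Context: All sets are subsets of $\mathbb{N}=\{0,1,2,\ldots\}$, identified with their characteristic functions. A many-one reduction from $A$ to $B$ is a total recursive function $f:\mathbb{N}\to\mathbb{N}$ with $A(x)=B(f(x))$ for all $x$. It is a finite-one reduction if for each $y$ there are at most finitely many $x$ with $f(x)=y$, and a one-one reduction if for each $y$ there is at most one $x$ with $f(x)=y$. $A$ is many-one (finite-one, one-one) reducible to $B$ if such a reduction exists; $A$ and $B$ are many-one (finite-one, one-one) equivalent if each is reducible to the other in that sense. The many-one (finite-one, one-one) degree of $A$ is the set of all $B\subseteq\mathbb{N}$ equivalent to $A$ in that sense. $A$ is in the greatest one-one degree of its many-one degree if every set in the many-one degree of $A$ is one-one reducible to $A$. *)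

theory Defs
  imports Main
begin

text \<open>
  Programs for partial recursive functions, with a big-step semantics on argument lists.
  Arities are not tracked in the syntax: once the length of the argument list at the root is
  fixed, the length at every subprogram is determined. Where no rule applies,
  for example for an out-of-range projection, the program is undefined. The recursion
  argument of \<open>PrimRec\<close> and the search variable of \<open>Mu\<close> come first.
\<close>

datatype recf =
    Zero
  | Succ
  | Proj nat
  | Comp recf "recf list"
  | PrimRec recf recf
  | Mu recf

inductive computes :: "recf \<Rightarrow> nat list \<Rightarrow> nat \<Rightarrow> bool" where
  Zero: "computes Zero xs 0"
| Succ: "computes Succ [x] (Suc x)"
| Proj: "i < length xs \<Longrightarrow> computes (Proj i) xs (xs ! i)"
| Comp: "list_all2 (\<lambda>g y. computes g xs y) gs ys \<Longrightarrow> computes f ys z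
    \<Longrightarrow> computes (Comp f gs) xs z"
| PrimRec_0: "computes f xs y \<Longrightarrow> computes (PrimRec f g) (0 # xs) y"
| PrimRec_Suc: "computes (PrimRec f g) (n # xs) r \<Longrightarrow> computes g (n # r # xs) y
    \<Longrightarrow> computes (PrimRec f g) (Suc n # xs) y"
| Mu: "computes f (n # xs) 0 \<Longrightarrow> \<forall>m<n. \<exists>y. computes f (m # xs) (Suc y)
    \<Longrightarrow> computes (Mu f) xs n"

inductive_cases computes_ZeroE: "computes Zero xs y"
inductive_cases computes_SuccE: "computes Succ xs y"
inductive_cases computes_ProjE: "computes (Proj i) xs y"
inductive_cases computes_CompE: "computes (Comp f gs) xs y"
inductive_cases computes_PrimRec_0E: "computes (PrimRec f g) (0 # xs) y"
inductive_cases computes_PrimRec_SucE: "computes (PrimRec f g) (Suc n # xs) y"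
inductive_cases computes_MuE: "computes (Mu f) xs y"

lemma computes_deterministic:
  assumes "computes p xs y" and "computes p xs z"
  shows "y = z"
  using assms
proof (induction arbitrary: z rule: computes.induct)
  case (Zero xs)
  then show ?case by (auto elim: computes_ZeroE)
next
  case (Succ x)
  then show ?case by (auto elim: computes_SuccE)
next
  case (Proj i xs)
  then show ?case by (auto elim: computes_ProjE)
next
  case (Comp xs gs ys f v)
  from Comp.prems obtain ys' where ys': "list_all2 (\<lambda>g y. computes g xs y) gs ys'"
    and f: "computes f ys' z"
    by (rule computes_CompE)
  have "ys = ys'"
  proof (rule nth_equalityI)
    show "length ys = length ys'"
      using Comp.IH(1) ys' by (simp add: list_all2_lengthD[symmetric])
    fix i assume "i < length ys"
    then show "ys ! i = ys' ! i"
      using Comp.IH(1) ys' by (simp add: list_all2_conv_all_nth)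
  qed
  with f Comp.IH show ?case by simp
next
  case (PrimRec_0 f xs y g)
  from PrimRec_0.prems have "computes f xs z" by (rule computes_PrimRec_0E)
  then show ?case by (rule PrimRec_0.IH)
next
  case (PrimRec_Suc f g n xs r y)
  from PrimRec_Suc.prems obtain r' where r': "computes (PrimRec f g) (n # xs) r'"
    and z: "computes g (n # r' # xs) z"
    by (rule computes_PrimRec_SucE)
  from r' have "r = r'" by (rule PrimRec_Suc.IH(1))
  with z show ?case using PrimRec_Suc.IH(2) by simp
next
  case (Mu f n xs)
  from Mu.prems have z: "computes f (z # xs) 0" "\<forall>m<z. \<exists>y. computes f (m # xs) (Suc y)"
    by (auto elim: computes_MuE)
  have "\<not> n < z"
    using z(2) Mu.IH by (metis nat.distinct(1))
  moreover have "\<not> z < n"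
    using z(1) Mu.IH by (metis nat.distinct(1))
  ultimately show ?case by simp
qed

text \<open>
  By determinism, the condition below says that the unary partial recursive function
  computed by \<open>p\<close> is total and equal to \<open>f\<close>.
\<close>

definition total_recursive :: "(nat \<Rightarrow> nat) \<Rightarrow> bool" where
  "total_recursive f \<longleftrightarrow> (\<exists>p. \<forall>x. computes p [x] (f x))"

definition many_one_reduction :: "(nat \<Rightarrow> nat) \<Rightarrow> nat set \<Rightarrow> nat set \<Rightarrow> bool" where
  "many_one_reduction f A B \<longleftrightarrow> total_recursive f \<and> (\<forall>x. x \<in> A \<longleftrightarrow> f x \<in> B)"

definition finite_one_reduction :: "(nat \<Rightarrow> nat) \<Rightarrow> nat set \<Rightarrow> nat set \<Rightarrow> bool" where
  "finite_one_reduction f A B \<longleftrightarrow> many_one_reduction f A B \<and> (\<forall>y. finite {x. f x = y})"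

definition one_one_reduction :: "(nat \<Rightarrow> nat) \<Rightarrow> nat set \<Rightarrow> nat set \<Rightarrow> bool" where
  "one_one_reduction f A B \<longleftrightarrow> many_one_reduction f A B \<and> inj f"

definition many_one_reducible :: "nat set \<Rightarrow> nat set \<Rightarrow> bool" where
  "many_one_reducible A B \<longleftrightarrow> (\<exists>f. many_one_reduction f A B)"

definition finite_one_reducible :: "nat set \<Rightarrow> nat set \<Rightarrow> bool" where
  "finite_one_reducible A B \<longleftrightarrow> (\<exists>f. finite_one_reduction f A B)"

definition one_one_reducible :: "nat set \<Rightarrow> nat set \<Rightarrow> bool" where
  "one_one_reducible A B \<longleftrightarrow> (\<exists>f. one_one_reduction f A B)"

definition many_one_equivalent :: "nat set \<Rightarrow> nat set \<Rightarrow> bool" where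
  "many_one_equivalent A B \<longleftrightarrow> many_one_reducible A B \<and> many_one_reducible B A"

definition finite_one_equivalent :: "nat set \<Rightarrow> nat set \<Rightarrow> bool" where
  "finite_one_equivalent A B \<longleftrightarrow> finite_one_reducible A B \<and> finite_one_reducible B A"

definition one_one_equivalent :: "nat set \<Rightarrow> nat set \<Rightarrow> bool" where
  "one_one_equivalent A B \<longleftrightarrow> one_one_reducible A B \<and> one_one_reducible B A"

definition many_one_degree :: "nat set \<Rightarrow> nat set set" where
  "many_one_degree A = {B. many_one_equivalent B A}"

definition in_greatest_one_one_degree :: "nat set \<Rightarrow> bool" where
  "in_greatest_one_one_degree A \<longleftrightarrow> (\<forall>B \<in> many_one_degree A. one_one_reducible B A)"

end

theory Submission
  imports Defs Complex_Main "HOL-Library.Nat_Bijection"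
begin

text \<open>
  If \<open>A\<close> is in the greatest one-one degree of its many-one degree, the constant sequence \<open>A\<close> is
  as required. Otherwise every \<open>B k\<close> is obtained from \<open>A\<close> by replacing each number by finitely
  many copies of itself: \<open>B k = {u. original k u \<in> A}\<close>, where the recursive function
  \<open>original k\<close> tells which number \<open>u\<close> is a copy of. Each number has a copy known in advance, so
  \<open>A\<close> is one-one reducible to \<open>B k\<close>, and \<open>original k\<close> is a finite-one reduction of \<open>B k\<close> to
  \<open>A\<close>. It remains to distribute the copies so that, for \<open>i \<noteq> j\<close>, a one-one reduction \<open>f\<close> of
  \<open>B i\<close> to \<open>B j\<close> would put \<open>A\<close> into the greatest one-one degree.

  Such an \<open>f\<close> gives for each \<open>x\<close> a recursively enumerable set \<open>S x\<close>: start with \<open>x\<close>, and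
  whenever \<open>u\<close> is an \<open>i\<close>-copy of an element, add the number of which \<open>f u\<close> is a \<open>j\<close>-copy. All
  elements of \<open>S x\<close> agree with \<open>x\<close> about membership in \<open>A\<close>. If \<open>S x\<close> is infinite for almost
  all \<open>x\<close>, every many-one reduction to \<open>A\<close> can be made one-one by moving its values inside
  these sets to values that have not been used yet (lemma \<open>greatest_if_infinite_classes\<close>;
  finitely many exceptional values can be replaced by fixed ones, one in \<open>A\<close> and one outside).
  If on the other hand \<open>S x\<close> is finite, then \<open>f\<close> maps the \<open>i\<close>-copies of its elements
  injectively to \<open>j\<close>-copies of its elements, and the construction can defeat this by making
  more \<open>i\<close>-copies of the maximum of \<open>S x\<close> than there are \<open>j\<close>-copies of all numbers up to it.

  It is not decidable which \<open>S x\<close> are finite, and requirements \<open>(i, j, e)\<close> and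
  \<open>(j, i, e')\<close> could outbid each other at the same number for ever. Therefore at each stage the
  \<open>r\<close>-th requirement claims only one number, namely the least \<open>y \<ge> r\<close> that is at this stage the
  maximum of one of its sets and is not claimed by an earlier requirement, and it may make copies
  of this number only. Since the maxima can only grow, it is eventually constant whether a given
  requirement claims a given number (lemma \<open>settles_claim\<close>). So each number has in the long run
  at most one claimant, and each number gets only finitely many copies (lemma
  \<open>original_eventually_avoids\<close>). If infinitely many \<open>S x\<close> of a requirement were finite, its claim
  would converge to the maximum of a finite \<open>S x\<close> (lemma \<open>claim_converges\<close>); by the injection
  above it would then always lack copies and go on copying this number for ever, which is
  impossible (lemma \<open>finite_reach_exceptional\<close>).

  To carry out the construction by programs of type \<^typ>\<open>recf\<close>, recursive functions are
  transported along bijective encodings to tuples and lists, where they are closed under the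
  usual operations. The universal function is replaced by an enumeration of all true statements
  \<^term>\<open>computes p xs y\<close>, obtained by treating the rules of the semantics as a proof system.
\<close>

section \<open>Programs for pairing and unpairing\<close>

lemma computes_Comp1:
  assumes "computes g xs a" and "computes f [a] z"
  shows "computes (Comp f [g]) xs z"
  using assms by (auto intro: computes.Comp)

lemma computes_Comp2:
  assumes "computes g xs a" and "computes h xs b" and "computes f [a, b] z"
  shows "computes (Comp f [g, h]) xs z"
  using assms by (auto intro: computes.Comp)

lemma computes_Proj:
  assumes "i < length xs" and "xs ! i = y"
  shows "computes (Proj i) xs y"
  using computes.Proj assms by blast

lemma computes_PrimRec:
  assumes "computes f xs a" and "\<And>k r. computes g (k # r # xs) (h k r)"
  shows "computes (PrimRec f g) (n # xs) (rec_nat a h n)"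
  by (induction n) (auto intro: computes.PrimRec_0 computes.PrimRec_Suc assms)

definition "add_prog = PrimRec (Proj 0) (Comp Succ [Proj 1])"
definition "triangle_prog = PrimRec Zero (Comp add_prog [Proj 1, Comp Succ [Proj 0]])"
definition "pair_prog = Comp add_prog [Comp triangle_prog [add_prog], Proj 0]"
definition "pred_prog = PrimRec Zero (Proj 0)"
definition "monus_prog = Comp (PrimRec (Proj 0) (Comp pred_prog [Proj 1])) [Proj 1, Proj 0]"
definition "row_prog =
  Mu (Comp monus_prog [Comp Succ [Proj 1], Comp triangle_prog [Comp Succ [Proj 0]]])"
definition "fst_prog = Comp monus_prog [Proj 0, Comp triangle_prog [row_prog]]"
definition "snd_prog = Comp monus_prog [row_prog, fst_prog]"

lemma computes_add: "computes add_prog [m, n] (m + n)"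
proof -
  have "computes add_prog [m, n] (rec_nat n (\<lambda>k r. Suc r) m)"
    unfolding add_prog_def
    by (intro computes_PrimRec computes_Comp1[OF _ computes.Succ]) (simp_all add: computes_Proj)
  moreover have "rec_nat n (\<lambda>k r. Suc r) m = m + n"
    by (induction m) auto
  ultimately show ?thesis by simp
qed

lemma computes_triangle: "computes triangle_prog [n] (triangle n)"
proof -
  have "computes triangle_prog [n] (rec_nat 0 (\<lambda>k r. r + Suc k) n)"
    unfolding triangle_prog_def
    by (intro computes_PrimRec computes.Zero computes_Comp2[OF _ _ computes_add]
        computes_Comp1[OF _ computes.Succ]) (simp_all add: computes_Proj)
  moreover have "rec_nat 0 (\<lambda>k r. r + Suc k) n = triangle n"
    by (induction n) auto
  ultimately show ?thesis by simp
qed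

lemma computes_pair: "computes pair_prog [m, n] (prod_encode (m, n))"
  unfolding pair_prog_def prod_encode_def prod.case
  by (rule computes_Comp2[OF computes_Comp1[OF computes_add computes_triangle] _ computes_add])
    (simp add: computes_Proj)

lemma computes_pred: "computes pred_prog [n] (n - 1)"
proof -
  have "computes pred_prog [n] (rec_nat 0 (\<lambda>k r. k) n)"
    unfolding pred_prog_def
    by (rule computes_PrimRec) (auto intro!: computes.Zero computes_Proj)
  moreover have "rec_nat 0 (\<lambda>k r. k) n = n - 1"
    by (cases n) auto
  ultimately show ?thesis by simp
qed

lemma computes_monus: "computes monus_prog [m, n] (m - n)"
proof -
  have "computes (PrimRec (Proj 0) (Comp pred_prog [Proj 1])) [n, m]
      (rec_nat m (\<lambda>k r. r - 1) n)"
    by (intro computes_PrimRec computes_Comp1[OF _ computes_pred]) (simp_all add: computes_Proj)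
  moreover have "rec_nat m (\<lambda>k r. r - 1) n = m - n"
    by (induction n) auto
  ultimately have "computes (PrimRec (Proj 0) (Comp pred_prog [Proj 1])) [n, m] (m - n)"
    by simp
  then show ?thesis
    unfolding monus_prog_def by (rule computes_Comp2[rotated 2]) (simp_all add: computes_Proj)
qed

lemma triangle_mono: "m \<le> n \<Longrightarrow> triangle m \<le> triangle n"
  by (induction rule: dec_induct) auto

text \<open>
  The pairs \<open>(m, n)\<close> are numbered along the diagonals \<open>m + n = w\<close>, and the diagonal \<open>w\<close> starts
  at \<open>triangle w\<close>. So unpairing only needs to find the diagonal, which is the least \<open>w\<close> such
  that the next diagonal starts beyond the given number.
\<close>

lemma computes_row: "computes row_prog [prod_encode (m, n)] (m + n)"
proof -
  let ?z = "prod_encode (m, n)"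
  let ?p = "Comp monus_prog [Comp Succ [Proj 1], Comp triangle_prog [Comp Succ [Proj 0]]]"
  have p: "computes ?p [w, ?z] (Suc ?z - triangle (Suc w))" for w
    by (rule computes_Comp2[OF computes_Comp1[OF _ computes.Succ]
          computes_Comp1[OF computes_Comp1[OF _ computes.Succ] computes_triangle] computes_monus])
      (auto intro!: computes_Proj)
  have "Suc ?z - triangle (Suc (m + n)) = 0"
    by (simp add: prod_encode_def)
  moreover have "\<exists>y. Suc ?z - triangle (Suc w) = Suc y" if "w < m + n" for w
  proof -
    have "triangle (Suc w) \<le> ?z"
      using triangle_mono[of "Suc w" "m + n"] that by (simp add: prod_encode_def)
    then show ?thesis by presburger
  qed
  ultimately show ?thesis
    unfolding row_prog_def using p by (metis computes.Mu)
qed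

lemma computes_fst: "computes fst_prog [prod_encode (m, n)] m"
proof -
  have "prod_encode (m, n) - triangle (m + n) = m"
    by (simp add: prod_encode_def)
  then show ?thesis
    unfolding fst_prog_def
    by (metis computes_Comp2[OF computes.Proj computes_Comp1[OF computes_row computes_triangle]
          computes_monus] length_Cons nth_Cons_0 zero_less_Suc)
qed

lemma computes_snd: "computes snd_prog [prod_encode (m, n)] n"
  unfolding snd_prog_def
  using computes_Comp2[OF computes_row computes_fst computes_monus] by (metis add_diff_cancel_left')

section \<open>Recursive functions between encoded types\<close>

text \<open>
  Requiring a bijection, and not only an injection, makes \<open>decode\<close> a genuine inverse and turns each
  function that is computable on codes into one on the encoded type without any side condition
  about junk codes. In particular both \<open>encode\<close> and \<open>decode\<close> are computable because on codes
  they are the identity.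
\<close>

class encodable =
  fixes encode :: "'a \<Rightarrow> nat"
  assumes bij_encode: "bij encode"

definition decode :: "nat \<Rightarrow> 'a::encodable" where
  "decode = inv encode"

lemma decode_encode [simp]: "decode (encode x) = x"
  unfolding decode_def by (simp add: bij_encode bij_is_inj)

lemma encode_decode [simp]: "encode (decode n) = n"
  unfolding decode_def by (simp add: bij_encode bij_is_surj surj_f_inv_f)

lemma encode_eq_iff [simp]: "encode x = encode y \<longleftrightarrow> x = y"
  by (metis decode_encode)

instantiation nat :: encodable
begin
definition encode_nat_def [simp]: "encode (n::nat) = n"
instance by standard (simp add: bij_betw_def inj_on_def)
end

instantiation prod :: (encodable, encodable) encodable
begin
definition encode_prod :: "'a \<times> 'b \<Rightarrow> nat" where
  "encode_prod p = prod_encode (encode (fst p), encode (snd p))"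
instance
proof
  show "bij (encode :: 'a \<times> 'b \<Rightarrow> nat)"
  proof (rule bijI)
    show "inj (encode :: 'a \<times> 'b \<Rightarrow> nat)"
      by (rule injI) (simp add: encode_prod_def prod_eq_iff)
    show "surj (encode :: 'a \<times> 'b \<Rightarrow> nat)"
      by (rule surjI[of _ "\<lambda>n. (decode (fst (prod_decode n)), decode (snd (prod_decode n)))"])
        (simp add: encode_prod_def)
  qed
qed
end

lemma encode_Pair: "encode (x, y) = prod_encode (encode x, encode y)"
  by (simp add: encode_prod_def)

instantiation list :: (encodable) encodable
begin
definition encode_list :: "'a list \<Rightarrow> nat" where
  "encode_list xs = list_encode (map encode xs)"
instance
proof
  show "bij (encode :: 'a list \<Rightarrow> nat)"
  proof (rule bijI)
    show "inj (encode :: 'a list \<Rightarrow> nat)"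
      by (rule injI) (simp add: encode_list_def list_encode_eq inj_on_def inj_map_eq_map)
    show "surj (encode :: 'a list \<Rightarrow> nat)"
      by (rule surjI[of _ "\<lambda>n. map decode (list_decode n)"]) (simp add: encode_list_def comp_def)
  qed
qed
end

lemma encode_Nil: "encode [] = 0"
  by (simp add: encode_list_def)

lemma encode_Cons: "encode (x # xs) = Suc (prod_encode (encode x, encode xs))"
  by (simp add: encode_list_def)

definition computable :: "('a::encodable \<Rightarrow> 'b::encodable) \<Rightarrow> bool" where
  "computable f \<longleftrightarrow> (\<exists>p. \<forall>x. computes p [encode x] (encode (f x)))"

lemma computable_nat_iff: "computable (f :: nat \<Rightarrow> nat) \<longleftrightarrow> total_recursive f"
  by (simp add: computable_def total_recursive_def)

text \<open>
  The closure rules below have conclusions of the form \<open>computable (\<lambda>x. F (f x) (g x))\<close>, so that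
  the goal for a term built from known operations is solved by applying them in any order.
  Composition with an arbitrary function is not among them, as its conclusion would match any
  goal.
\<close>

named_theorems computable_intros

lemma computable_ident [computable_intros]: "computable (\<lambda>x. x)"
  unfolding computable_def by (rule exI[of _ "Proj 0"]) (simp add: computes_Proj)

lemma computable_comp:
  assumes "computable g" and "computable f"
  shows "computable (\<lambda>x. g (f x))"
proof -
  obtain p q where "\<And>x. computes p [encode x] (encode (g x))"
    "\<And>x. computes q [encode x] (encode (f x))"
    using assms unfolding computable_def by blast
  then show ?thesis
    unfolding computable_def by (blast intro: computes_Comp1)
qed

lemma computable_Suc [computable_intros]:
  assumes "computable f"
  shows "computable (\<lambda>x. Suc (f x))"
  by (rule computable_comp[OF _ assms]) (auto simp: computable_def intro: computes.Succ)

lemma computable_const [computable_intros]: "computable (\<lambda>x. c)"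
proof -
  have "\<exists>p. \<forall>x. computes p [x] n" for n
    by (induction n) (blast intro: computes.Zero computes_Comp1[OF _ computes.Succ])+
  then show ?thesis unfolding computable_def by blast
qed

lemma computable_Pair [computable_intros]:
  assumes "computable f" and "computable g"
  shows "computable (\<lambda>x. (f x, g x))"
proof -
  obtain p q where "\<And>x. computes p [encode x] (encode (f x))"
    "\<And>x. computes q [encode x] (encode (g x))"
    using assms unfolding computable_def by blast
  then show ?thesis
    unfolding computable_def encode_Pair by (blast intro: computes_Comp2 computes_pair)
qed

lemma computable_fst [computable_intros]:
  assumes "computable f"
  shows "computable (\<lambda>x. fst (f x))"
  by (rule computable_comp[OF _ assms])
    (auto simp: computable_def encode_prod_def intro: computes_fst)

lemma computable_snd [computable_intros]:
  assumes "computable f"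
  shows "computable (\<lambda>x. snd (f x))"
  by (rule computable_comp[OF _ assms])
    (auto simp: computable_def encode_prod_def intro: computes_snd)

lemma computable_rec_nat [computable_intros]:
  assumes "computable (\<lambda>p. h (fst p) (fst (snd p)) (snd (snd p)))"
    and "computable a" and "computable n"
  shows "computable (\<lambda>x. rec_nat (a x) (h x) (n x))"
proof -
  obtain H P N where
    H: "\<And>x k r. computes H [encode (x, k::nat, r)] (encode (h x k r))"
    and P: "\<And>x. computes P [encode x] (encode (a x))"
    and N: "\<And>x. computes N [encode x] (n x)"
    using assms unfolding computable_def by fastforce
  define S where "S = Comp H [Comp pair_prog [Proj 2, Comp pair_prog [Proj 0, Proj 1]]]"
  have step: "computes S [k, encode r, encode x] (encode (h x k r))" for k r x
    unfolding S_def
    by (rule computes_Comp1[OF computes_Comp2[OF _ computes_Comp2[OF _ _ computes_pair]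
            computes_pair] H[unfolded encode_Pair encode_nat_def]])
      (simp_all add: computes_Proj)
  have "computes (PrimRec P S) [m, encode x] (encode (rec_nat (a x) (h x) m))" for m x
    by (induction m) (auto intro: computes.PrimRec_0 computes.PrimRec_Suc[OF _ step] P)
  then have "computes (Comp (PrimRec P S) [N, Proj 0]) [encode x]
      (encode (rec_nat (a x) (h x) (n x)))" for x
    by (auto intro!: computes_Comp2 N computes_Proj)
  then show ?thesis unfolding computable_def by blast
qed

lemma computable_case_nat [computable_intros]:
  assumes "computable (\<lambda>p. h (fst p) (snd p))" and "computable a" and "computable n"
  shows "computable (\<lambda>x. case n x of 0 \<Rightarrow> a x | Suc k \<Rightarrow> h x k)"
proof -
  have "(case m of 0 \<Rightarrow> b | Suc k \<Rightarrow> f k) = rec_nat b (\<lambda>k _. f k) m" for m b and f :: "nat \<Rightarrow> 'b"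
    by (cases m) auto
  moreover have "computable (\<lambda>x. rec_nat (a x) (\<lambda>k _. h x k) (n x))"
  proof (rule computable_rec_nat[OF _ assms(2,3)])
    have "computable (\<lambda>p :: 'a \<times> nat \<times> 'b. (fst p, fst (snd p)))"
      by (intro computable_intros)
    from computable_comp[OF assms(1) this]
    show "computable (\<lambda>p :: 'a \<times> nat \<times> 'b. h (fst p) (fst (snd p)))" by simp
  qed
  ultimately show ?thesis by simp
qed

text \<open>
  The type \<^typ>\<open>bool\<close> has no bijection with the natural numbers, hence this separate notion for
  predicates.
\<close>

definition decidable :: "('a::encodable \<Rightarrow> bool) \<Rightarrow> bool" where
  "decidable P \<longleftrightarrow> computable (\<lambda>x. of_bool (P x) :: nat)"

lemma computable_If [computable_intros]:
  assumes "decidable P" and "computable f" and "computable g"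
  shows "computable (\<lambda>x. if P x then f x else g x)"
proof -
  have eq: "(if b then u else v) = rec_nat v (\<lambda>_ _. u) (of_bool b)" for b and u v :: 'b
    by (cases b) auto
  show ?thesis
    unfolding eq
    by (rule computable_rec_nat[OF computable_comp[OF assms(2)]])
      (intro computable_intros assms assms(1)[unfolded decidable_def])+
qed

lemma computable_Least [computable_intros]:
  assumes "decidable (\<lambda>p. P (fst p) (snd p))" and "\<And>x. \<exists>n. P x n"
  shows "computable (\<lambda>x. LEAST n::nat. P x n)"
proof -
  obtain H where H: "\<And>x n. computes H [prod_encode (encode x, n)] (of_bool (P x n))"
    using assms(1) unfolding decidable_def computable_def encode_prod_def by fastforce
  let ?q = "Comp monus_prog [Comp Succ [Zero], Comp H [Comp pair_prog [Proj 1, Proj 0]]]"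
  have q: "computes ?q [n, encode x] (1 - of_bool (P x n))" for n x
    unfolding One_nat_def
    by (rule computes_Comp2[OF computes_Comp1[OF computes.Zero computes.Succ]
            computes_Comp1[OF computes_Comp2[OF _ _ computes_pair] H] computes_monus])
      (auto intro!: computes_Proj)
  have "computes (Mu ?q) [encode x] (LEAST n. P x n)" for x
  proof (rule computes.Mu)
    show "computes ?q [LEAST n. P x n, encode x] 0"
      using q[of "LEAST n. P x n" x] LeastI_ex[OF assms(2)] by simp
    show "\<forall>m<LEAST n. P x n. \<exists>y. computes ?q [m, encode x] (Suc y)"
    proof (intro allI impI)
      fix m assume "m < (LEAST n. P x n)"
      then have "\<not> P x m" by (rule not_less_Least)
      then show "\<exists>y. computes ?q [m, encode x] (Suc y)"
        using q[of m x] by auto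
    qed
  qed
  then show ?thesis unfolding computable_def by auto
qed

lemma computable_comp2:
  assumes "computable (\<lambda>p. h (fst p) (snd p))" and "computable f" and "computable g"
  shows "computable (\<lambda>x. h (f x) (g x))"
  using computable_comp[OF assms(1) computable_Pair[OF assms(2,3)]] by simp

lemma computable_comp3:
  assumes "computable (\<lambda>p. h (fst p) (fst (snd p)) (snd (snd p)))"
    and "computable f" and "computable g" and "computable k"
  shows "computable (\<lambda>x. h (f x) (g x) (k x))"
  using computable_comp[OF assms(1) computable_Pair[OF assms(2) computable_Pair[OF assms(3,4)]]]
  by simp

lemma computable_case_prod [computable_intros]:
  assumes "computable (\<lambda>x. h x (fst (f x)) (snd (f x)))"
  shows "computable (\<lambda>x. case f x of (a, b) \<Rightarrow> h x a b)"
  using assms by (simp add: split_beta)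

lemma computable_Let [computable_intros]:
  assumes "computable (\<lambda>p. h (fst p) (snd p))" and "computable f"
  shows "computable (\<lambda>x. let y = f x in h x y)"
  unfolding Let_def by (rule computable_comp2[OF assms(1) computable_ident assms(2)])

lemma computable_encode [computable_intros]:
  assumes "computable f"
  shows "computable (\<lambda>x. encode (f x))"
  using assms by (simp add: computable_def)

lemma computable_decode [computable_intros]:
  assumes "computable f"
  shows "computable (\<lambda>x. decode (f x))"
  using assms by (simp add: computable_def)

lemma computable_pred: 
  assumes "computable f"
  shows "computable (\<lambda>x. f x - 1 :: nat)"
proof -
  have "n - 1 = (case n of 0 \<Rightarrow> 0 | Suc k \<Rightarrow> k)" for n :: nat
    by (cases n) auto
  then show ?thesis by (simp only:) (intro computable_intros assms)
qed

lemma computable_diff [computable_intros]: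
  assumes "computable f" and "computable g"
  shows "computable (\<lambda>x. f x - g x :: nat)"
proof -
  have eq: "m - n = rec_nat m (\<lambda>_ r. r - 1) n" for m n :: nat
    by (induction n) auto
  show ?thesis
    by (subst eq) (intro computable_rec_nat computable_pred computable_intros assms)
qed

lemma decidable_not [computable_intros]:
  assumes "decidable P"
  shows "decidable (\<lambda>x. \<not> P x)"
proof -
  have "(of_bool (\<not> b) :: nat) = 1 - of_bool b" for b by simp
  then show ?thesis
    using assms unfolding decidable_def by (simp only:) (intro computable_intros)
qed

lemma decidable_conj [computable_intros]:
  assumes "decidable P" and "decidable Q"
  shows "decidable (\<lambda>x. P x \<and> Q x)"
proof -
  have eq: "(of_bool (a \<and> b) :: nat) = (if a then of_bool b else 0)" for a b by simp
  show ?thesis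
    using assms(2) unfolding decidable_def eq
    by (intro computable_intros assms(1))
qed

lemma decidable_disj [computable_intros]:
  assumes "decidable P" and "decidable Q"
  shows "decidable (\<lambda>x. P x \<or> Q x)"
  using decidable_not[OF decidable_conj[OF assms[THEN decidable_not]]] by simp

lemma decidable_le [computable_intros]:
  assumes "computable f" and "computable g"
  shows "decidable (\<lambda>x. (f x :: nat) \<le> g x)"
proof -
  have eq: "(of_bool (m \<le> n) :: nat) = 1 - (m - n)" for m n :: nat by simp
  show ?thesis
    unfolding decidable_def eq by (intro computable_intros assms)
qed

lemma decidable_less [computable_intros]:
  assumes "computable f" and "computable g"
  shows "decidable (\<lambda>x. (f x :: nat) < g x)"
  using decidable_not[OF decidable_le[OF assms(2,1)]] by (simp add: not_le)

lemma decidable_eq [computable_intros]: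
  assumes "computable f" and "computable g"
  shows "decidable (\<lambda>x. f x = g x)"
proof -
  have "decidable (\<lambda>x. encode (f x) \<le> encode (g x) \<and> encode (g x) \<le> encode (f x))"
    by (intro computable_intros assms)
  moreover have "encode (f x) \<le> encode (g x) \<and> encode (g x) \<le> encode (f x) \<longleftrightarrow> f x = g x" for x
    by (metis encode_eq_iff order_antisym order_refl)
  ultimately show ?thesis by simp
qed

lemma computable_Cons [computable_intros]:
  assumes "computable f" and "computable g"
  shows "computable (\<lambda>x. f x # g x)"
proof -
  have "f x # g x = decode (Suc (encode (f x, g x)))" for x
    by (metis decode_encode encode_Cons encode_Pair)
  then show ?thesis by (simp only:) (intro computable_intros assms)
qed

lemma computable_case_list [computable_intros]:
  assumes "computable (\<lambda>p. h (fst p) (fst (snd p)) (snd (snd p)))"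
    and "computable a" and "computable xs"
  shows "computable (\<lambda>x. case xs x of [] \<Rightarrow> a x | y # ys \<Rightarrow> h x y ys)"
proof -
  have "(case zs of [] \<Rightarrow> b | y # ys \<Rightarrow> f y ys) =
      (case encode zs of 0 \<Rightarrow> b | Suc k \<Rightarrow> case decode k of (y, ys) \<Rightarrow> f y ys)"
    for b and f :: "'b \<Rightarrow> 'b list \<Rightarrow> 'c" and zs
    by (cases zs) (simp_all add: encode_Nil encode_Cons flip: encode_Pair)
  moreover have "computable (\<lambda>x. case encode (xs x) of 0 \<Rightarrow> a x
      | Suc k \<Rightarrow> case decode k of (y, ys) \<Rightarrow> h x y ys)"
  proof (intro computable_case_nat computable_intros assms(2,3))
    have "computable (\<lambda>p :: 'a \<times> nat. (fst p, (decode (snd p) :: 'b \<times> 'b list)))"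
      by (intro computable_intros)
    from computable_comp[OF assms(1) this]
    show "computable (\<lambda>p. h (fst p) (fst (decode (snd p) :: 'b \<times> 'b list))
        (snd (decode (snd p) :: 'b \<times> 'b list)))" by simp
  qed
  ultimately show ?thesis by simp
qed

lemma computable_tl [computable_intros]:
  assumes "computable xs"
  shows "computable (\<lambda>x. tl (xs x))"
proof -
  have "tl ys = (case ys of [] \<Rightarrow> [] | _ # l \<Rightarrow> l)" for ys :: "'b list"
    by (cases ys) auto
  then show ?thesis by (simp only:) (intro computable_intros assms)
qed

text \<open>
  The code of a list is at least its length, so it bounds the number of steps needed to run
  through the list. This reduces recursion on lists to recursion on numbers.
\<close>

lemma length_le_encode: "length xs \<le> encode xs"
proof (induction xs)
  case (Cons x xs)
  then show ?case
    using le_prod_encode_2[of "encode xs" "encode x"] by (simp add: encode_Cons)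
qed simp

lemma computable_foldl [computable_intros]:
  assumes "computable (\<lambda>p. h (fst p) (fst (snd p)) (snd (snd p)))"
    and "computable a" and "computable xs"
  shows "computable (\<lambda>x. foldl (h x) (a x) (xs x))"
proof -
  define step where "step = (\<lambda>x s. case snd s of [] \<Rightarrow> s | y # ys \<Rightarrow> (h x (fst s) y, ys))"
  have iterate: "fst (rec_nat (b, zs) (\<lambda>_. step x) n) = foldl (h x) b zs" if "length zs \<le> n"
    for x b zs n
  proof -
    have "rec_nat (b, zs) (\<lambda>_. step x) k = (foldl (h x) b (take k zs), drop k zs)" for k
    proof (induction k)
      case (Suc k)
      show ?case
      proof (cases "k < length zs")
        case True
        then have "step x (foldl (h x) b (take k zs), drop k zs) =
            (foldl (h x) b (take (Suc k) zs), drop (Suc k) zs)"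
          by (simp add: step_def take_Suc_conv_app_nth flip: Cons_nth_drop_Suc)
        then show ?thesis by (simp add: Suc)
      next
        case False
        then have "step x (foldl (h x) b (take k zs), drop k zs) =
            (foldl (h x) b (take (Suc k) zs), drop (Suc k) zs)"
          by (simp add: step_def)
        then show ?thesis by (simp add: Suc)
      qed
    qed simp
    with that show ?thesis by simp
  qed
  have "computable (\<lambda>x. fst (rec_nat (a x, xs x) (\<lambda>_. step x) (encode (xs x))))"
    unfolding step_def by (intro computable_intros computable_comp3[OF assms(1)] assms(2,3))
  then show ?thesis by (simp add: iterate length_le_encode)
qed

lemma computable_rev [computable_intros]:
  assumes "computable xs"
  shows "computable (\<lambda>x. rev (xs x))"
proof -
  have "foldl (\<lambda>zs y. y # zs) ws ys = rev ys @ ws" for ws ys :: "'b list"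
    by (induction ys arbitrary: ws) auto
  then have "rev ys = foldl (\<lambda>zs y. y # zs) [] ys" for ys :: "'b list" by simp
  then show ?thesis by (simp only:) (intro computable_intros assms)
qed

lemma computable_foldr [computable_intros]:
  assumes "computable (\<lambda>p. h (fst p) (fst (snd p)) (snd (snd p)))"
    and "computable xs" and "computable a"
  shows "computable (\<lambda>x. foldr (h x) (xs x) (a x))"
proof -
  have "computable (\<lambda>p. h (fst p) (snd (snd p)) (fst (snd p)))"
    using computable_comp[OF assms(1), of "\<lambda>p. (fst p, snd (snd p), fst (snd p))"]
    by (simp add: computable_intros)
  then show ?thesis
    unfolding foldr_conv_foldl by (intro computable_intros assms(2,3))
qed

lemma computable_append [computable_intros]:
  assumes "computable xs" and "computable ys"
  shows "computable (\<lambda>x. xs x @ ys x)"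
proof -
  have "zs @ ws = foldr (\<lambda>y l. y # l) zs ws" for zs ws :: "'b list"
    by (induction zs) auto
  then show ?thesis by (simp only:) (intro computable_intros assms)
qed

lemma computable_map [computable_intros]:
  assumes "computable (\<lambda>p. h (fst p) (snd p))" and "computable xs"
  shows "computable (\<lambda>x. map (h x) (xs x))"
proof -
  have "map f ys = foldr (\<lambda>y l. f y # l) ys []" for f :: "'b \<Rightarrow> 'c" and ys
    by (induction ys) auto
  moreover have "computable (\<lambda>p :: 'a \<times> 'b \<times> 'c list. h (fst p) (fst (snd p)))"
    using computable_comp[OF assms(1), of "\<lambda>p :: 'a \<times> 'b \<times> 'c list. (fst p, fst (snd p))"]
    by (simp add: computable_intros)
  ultimately show ?thesis by (simp only:) (intro computable_intros assms(2))
qed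

lemma computable_filter [computable_intros]:
  assumes "decidable (\<lambda>p. P (fst p) (snd p))" and "computable xs"
  shows "computable (\<lambda>x. filter (P x) (xs x))"
proof -
  have "filter Q ys = foldr (\<lambda>y l. if Q y then y # l else l) ys []" for Q and ys :: "'b list"
    by (induction ys) auto
  moreover have "decidable (\<lambda>p :: 'a \<times> 'b \<times> 'b list. P (fst p) (fst (snd p)))"
    unfolding decidable_def
    using computable_comp[OF assms(1)[unfolded decidable_def],
        of "\<lambda>p :: 'a \<times> 'b \<times> 'b list. (fst p, fst (snd p))"]
    by (simp add: computable_intros)
  ultimately show ?thesis by (simp only:) (intro computable_intros assms(2))
qed

lemma computable_length [computable_intros]:
  assumes "computable xs"
  shows "computable (\<lambda>x. length (xs x))"
proof -
  have "foldl (\<lambda>n _. Suc n) k ys = k + length ys" for k and ys :: "'b list"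
    by (induction ys arbitrary: k) auto
  then have "length ys = foldl (\<lambda>n _. Suc n) 0 ys" for ys :: "'b list" by simp
  then show ?thesis by (simp only:) (intro computable_intros assms)
qed

lemma computable_upt [computable_intros]:
  assumes "computable n"
  shows "computable (\<lambda>x. [0..<n x])"
proof -
  have "[0..<k] = rec_nat [] (\<lambda>i l. l @ [i]) k" for k
    by (induction k) auto
  then show ?thesis by (simp only:) (intro computable_intros assms)
qed

lemma decidable_Bex_set [computable_intros]:
  assumes "decidable (\<lambda>p. P (fst p) (snd p))" and "computable xs"
  shows "decidable (\<lambda>x. \<exists>y \<in> set (xs x). P x y)"
proof -
  have "(\<exists>y \<in> set ys. Q y) \<longleftrightarrow> filter Q ys \<noteq> []" for Q and ys :: "'b list"
    by (simp add: filter_empty_conv)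
  then show ?thesis by (simp only:) (intro computable_intros assms)
qed

lemma decidable_Ball_set [computable_intros]:
  assumes "decidable (\<lambda>p. P (fst p) (snd p))" and "computable xs"
  shows "decidable (\<lambda>x. \<forall>y \<in> set (xs x). P x y)"
  using decidable_not[OF decidable_Bex_set[OF decidable_not[OF assms(1)] assms(2)]] by simp

lemma decidable_mem_set [computable_intros]:
  assumes "computable f" and "computable xs"
  shows "decidable (\<lambda>x. f x \<in> set (xs x))"
proof -
  have "f x \<in> set (xs x) \<longleftrightarrow> (\<exists>y \<in> set (xs x). f x = y)" for x by simp
  then show ?thesis
    by (simp only:) (intro computable_intros computable_comp[OF assms(1)] assms(2))
qed

definition lookup :: "'a \<Rightarrow> 'a list \<Rightarrow> nat \<Rightarrow> 'a" where
  "lookup d xs n = (if n < length xs then xs ! n else d)"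

lemma computable_lookup [computable_intros]:
  assumes "computable d" and "computable xs" and "computable n"
  shows "computable (\<lambda>x. lookup (d x) (xs x) (n x))"
proof -
  have drop: "drop k ys = rec_nat ys (\<lambda>_ l. tl l) k" for k and ys :: "'b list"
    by (induction k) (simp_all add: drop_Suc flip: tl_drop)
  have "lookup e ys k = (case drop k ys of [] \<Rightarrow> e | y # _ \<Rightarrow> y)" for e k and ys :: "'b list"
    by (cases "k < length ys") (auto simp: lookup_def simp flip: Cons_nth_drop_Suc)
  then show ?thesis unfolding drop by (simp only:) (intro computable_intros assms)
qed

text \<open>
  Stage constructions in which a stage may use all previous results are instances of this
  scheme; \<open>step\<close> finds the number of the stage as the length of the list.
\<close>

lemma computable_course_of_values:
  assumes "computable step" and "\<And>n. F n = step (map F [0..<n])"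
  shows "computable F"
proof -
  have "map F [0..<n] = rec_nat [] (\<lambda>_ h. h @ [step h]) n" for n
  proof (induction n)
    case (Suc n)
    then show ?case using assms(2)[of n] by simp
  qed simp
  then have "F = (\<lambda>n. step (rec_nat [] (\<lambda>_ h. h @ [step h]) n))"
    by (intro ext) (metis assms(2))
  moreover have "computable (\<lambda>n. step (rec_nat [] (\<lambda>_ h. h @ [step h]) n))"
    by (intro computable_intros computable_comp[OF assms(1)])
  ultimately show ?thesis by simp
qed

section \<open>Enumerating all computations\<close>

text \<open>
  Only some numbers are codes of programs. The enumeration also produces facts about the others,
  which is harmless since they cannot be confused with facts about codes of programs.
\<close>

fun code :: "recf \<Rightarrow> nat" where
  "code Zero = encode (0::nat, 0::nat)"
| "code Succ = encode (1::nat, 0::nat)"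
| "code (Proj i) = encode (2::nat, i)"
| "code (Comp f gs) = encode (3::nat, code f, map code gs)"
| "code (PrimRec f g) = encode (4::nat, code f, code g)"
| "code (Mu f) = encode (5::nat, code f)"

type_synonym fact = "nat \<times> nat list \<times> nat"

text \<open>
  An instance of a rule of the semantics is given by the number of the rule and by values for
  everything that occurs in the rule, in one format for all rules: for \<open>Comp\<close> the list of pairs
  contains the codes of the inner programs with their values, and for \<open>Mu\<close> the list \<open>ys\<close>
  contains the predecessors of the values at the arguments below the result, which is the length
  of \<open>ys\<close>. The arguments of \<open>Proj\<close> are \<open>ys @ n # xs\<close> with the projected value \<open>n\<close>. The rule
  numbers outside 1 to 6 stand for the axiom for \<open>Zero\<close>.
\<close>

type_synonym rule_instance =
  "nat \<times> nat \<times> nat \<times> nat list \<times> (nat \<times> nat) list \<times> nat list \<times> nat \<times> nat \<times> nat"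

definition antecedents :: "rule_instance \<Rightarrow> fact list" where
  "antecedents = (\<lambda>(tag, f, g, xs, gys, ys, n, r, z).
     if tag = 3 then (f, map snd gys, z) # map (\<lambda>gy. (fst gy, xs, snd gy)) gys
     else if tag = 4 then [(f, xs, z)]
     else if tag = 5 then [(encode (4::nat, f, g), n # xs, r), (g, n # r # xs, z)]
     else if tag = 6 then
       (f, length ys # xs, 0) # map (\<lambda>m. (f, m # xs, Suc (lookup 0 ys m))) [0..<length ys]
     else [])"

definition conclusion :: "rule_instance \<Rightarrow> fact" where
  "conclusion = (\<lambda>(tag, f, g, xs, gys, ys, n, r, z).
     if tag = 1 then (encode (1::nat, 0::nat), [n], Suc n)
     else if tag = 2 then (encode (2::nat, length ys), ys @ n # xs, n)
     else if tag = 3 then (encode (3::nat, f, map fst gys), xs, z)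
     else if tag = 4 then (encode (4::nat, f, g), 0 # xs, z)
     else if tag = 5 then (encode (4::nat, f, g), Suc n # xs, z)
     else if tag = 6 then (encode (5::nat, f), xs, length ys)
     else (encode (0::nat, 0::nat), xs, 0))"

inductive derivable :: "fact \<Rightarrow> bool" where
  "list_all derivable (antecedents i) \<Longrightarrow> derivable (conclusion i)"
monos list.pred_mono

lemma computable_antecedents [computable_intros]:
  assumes "computable i"
  shows "computable (\<lambda>x. antecedents (i x))"
  by (rule computable_comp[OF _ assms]) (unfold antecedents_def, intro computable_intros)

lemma computable_conclusion [computable_intros]:
  assumes "computable i"
  shows "computable (\<lambda>x. conclusion (i x))"
  by (rule computable_comp[OF _ assms]) (unfold conclusion_def, intro computable_intros)

text \<open>
  The number \<open>t\<close> is read as a rule instance together with padding. If its antecedents have been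
  enumerated before, its conclusion comes next, otherwise a fixed derivable fact. The padding
  delays each instance until its antecedents are there, and makes every fact appear infinitely
  often.
\<close>

fun fact_at :: "nat \<Rightarrow> fact" where
  "fact_at t =
    (let i = fst (decode t :: rule_instance \<times> nat) in
     if \<forall>p \<in> set (antecedents i). p \<in> set (map fact_at [0..<t]) then conclusion i
     else (encode (0::nat, 0::nat), [], 0))"

declare fact_at.simps [simp del]

lemma computable_fact_at: "computable fact_at"
proof (rule computable_course_of_values)
  let ?step = "\<lambda>h :: fact list.
    (let i = fst (decode (length h) :: rule_instance \<times> nat) in
     if \<forall>p \<in> set (antecedents i). p \<in> set h then conclusion i
     else (encode (0::nat, 0::nat), [], 0))"
  show "computable ?step"
    by (intro computable_intros)
  show "fact_at n = ?step (map fact_at [0..<n])" for n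
    by (subst fact_at.simps) simp
qed

lemma derivable_Zero: "derivable (encode (0::nat, 0::nat), xs, 0)"
  using derivable.intros[of "(0, 0, 0, xs, [], [], 0, 0, 0)"]
  by (simp add: antecedents_def conclusion_def)

lemma derivable_fact_at: "derivable (fact_at t)"
proof (induction t rule: less_induct)
  case (less t)
  show ?case
  proof (subst fact_at.simps, simp only: Let_def, split if_split, intro conjI impI)
    assume "\<forall>p \<in> set (antecedents (fst (decode t :: rule_instance \<times> nat))).
      p \<in> set (map fact_at [0..<t])"
    then have "list_all derivable (antecedents (fst (decode t :: rule_instance \<times> nat)))"
      using less by (auto simp: list_all_iff)
    then show "derivable (conclusion (fst (decode t :: rule_instance \<times> nat)))"
      by (rule derivable.intros)
  qed (rule derivable_Zero)
qed

lemma fact_at_surj: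
  assumes "derivable p"
  shows "\<exists>t\<ge>N. fact_at t = p"
  using assms
proof (induction arbitrary: N rule: derivable.induct)
  case (1 i)
  have "\<forall>p \<in> set (antecedents i). \<exists>t. fact_at t = p"
    using 1 by (auto simp: list_all_iff)
  then obtain T where T: "\<And>p. p \<in> set (antecedents i) \<Longrightarrow> fact_at (T p) = p"
    by metis
  obtain M where M: "\<And>p. p \<in> set (antecedents i) \<Longrightarrow> T p < M"
    using finite_nat_set_iff_bounded[of "T ` set (antecedents i)"] by auto
  define t where "t = encode (i, max M N)"
  have "max M N \<le> t"
    unfolding t_def encode_Pair using le_prod_encode_2 by simp
  moreover have "fact_at t = conclusion i"
  proof -
    have "\<forall>p \<in> set (antecedents i). p \<in> set (map fact_at [0..<t])"
    proof
      fix p assume p: "p \<in> set (antecedents i)"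
      have "T p < t" using M[OF p] \<open>max M N \<le> t\<close> by simp
      then have "fact_at (T p) \<in> set (map fact_at [0..<t])" by simp
      then show "p \<in> set (map fact_at [0..<t])" using T[OF p] by simp
    qed
    then show ?thesis by (subst fact_at.simps) (simp add: t_def)
  qed
  ultimately show ?case by auto
qed

lemma derivable_complete: "computes p xs y \<Longrightarrow> derivable (code p, xs, y)"
proof (induction rule: computes.induct)
  case (Zero xs)
  show ?case using derivable_Zero by simp
next
  case (Succ x)
  show ?case
    using derivable.intros[of "(1, 0, 0, [], [], [], x, 0, 0)"]
    by (simp add: antecedents_def conclusion_def)
next
  case (Proj i xs)
  then show ?case
    using derivable.intros[of "(2, 0, 0, drop (Suc i) xs, [], take i xs, xs ! i, 0, 0)"]
    by (simp add: antecedents_def conclusion_def flip: id_take_nth_drop)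
next
  case (Comp xs gs ys f z)
  define gys where "gys = zip (map code gs) ys"
  have "length gs = length ys"
    using Comp.IH(1) by (rule list_all2_lengthD)
  then have "map snd gys = ys" "map fst gys = map code gs"
    by (simp_all add: gys_def)
  moreover have "\<forall>gy \<in> set gys. derivable (fst gy, xs, snd gy)"
    using Comp.IH(1) by (auto simp: gys_def set_zip list_all2_conv_all_nth)
  ultimately show ?case
    using derivable.intros[of "(3, code f, 0, xs, gys, [], 0, 0, z)"] Comp.IH(2)
    by (simp add: antecedents_def conclusion_def list_all_iff)
next
  case (PrimRec_0 f xs y g)
  then show ?case
    using derivable.intros[of "(4, code f, code g, xs, [], [], 0, 0, y)"]
    by (simp add: antecedents_def conclusion_def)
next
  case (PrimRec_Suc f g n xs r y)
  then show ?case
    using derivable.intros[of "(5, code f, code g, xs, [], [], n, r, y)"]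
    by (simp add: antecedents_def conclusion_def)
next
  case (Mu f n xs)
  then obtain Y where Y: "\<And>m. m < n \<Longrightarrow> derivable (code f, m # xs, Suc (Y m))"
    by metis
  then show ?case
    using derivable.intros[of "(6, code f, 0, xs, [], map Y [0..<n], 0, 0, 0)"] Mu.IH(1)
    by (simp add: antecedents_def conclusion_def list_all_iff lookup_def)
qed

text \<open>
  Rules may be instantiated with numbers that are not codes, for example for the step program of
  a primitive recursion that stops at 0. The statement only speaks of facts whose first component
  is a code; \<open>code\<close> determines the outermost constructor, so the induction carries this over to
  the antecedents that matter.
\<close>

lemma derivable_sound:
  "derivable q \<Longrightarrow> q = (code p, xs, y) \<Longrightarrow> computes p xs y"
proof (induction arbitrary: p xs y rule: derivable.induct)
  case (1 i)
  obtain tag f g zs gys ys n r z where i: "i = (tag, f, g, zs, gys, ys, n, r, z)"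
    by (metis surj_pair)
  have IH: "computes p xs y" if "(code p, xs, y) \<in> set (antecedents i)" for p xs y
    using 1(1) that by (auto simp: list_all_iff)
  have concl: "conclusion i = (code p, xs, y)" by (rule 1(2))
  consider "tag = 1" | "tag = 2" | "tag = 3" | "tag = 4" | "tag = 5" | "tag = 6"
    | "tag \<notin> {1, 2, 3, 4, 5, 6}"
    by blast
  then show ?case
  proof cases
    case 1
    then have "p = Succ" "xs = [n]" "y = Suc n"
      using concl by (cases p; simp add: i conclusion_def encode_Pair)+
    then show ?thesis by (simp add: computes.Succ)
  next
    case 2
    then have "p = Proj (length ys)" "xs = ys @ n # zs" "y = n"
      using concl by (cases p; simp add: i conclusion_def encode_Pair)+
    then show ?thesis by (simp add: computes_Proj)
  next
    case 3
    then obtain f' gs where p: "p = Comp f' gs" "code f' = f" "map code gs = map fst gys"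
        and "xs = zs" "y = z"
      using concl by (cases p) (auto simp: i conclusion_def encode_Pair)
    have "computes f' (map snd gys) y"
      using 3 by (intro IH) (simp add: i antecedents_def p \<open>y = z\<close>)
    moreover have "list_all2 (\<lambda>g y. computes g xs y) gs (map snd gys)"
    proof (rule list_all2_all_nthI)
      show "length gs = length (map snd gys)"
        using p(3) by (metis length_map)
      fix k assume k: "k < length gs"
      then have "k < length gys" "code (gs ! k) = fst (gys ! k)"
        using p(3) by (metis length_map nth_map)+
      then show "computes (gs ! k) xs (map snd gys ! k)"
        using 3 by (intro IH) (auto simp: i antecedents_def \<open>xs = zs\<close> image_iff)
    qed
    ultimately show ?thesis unfolding p(1) by (intro computes.Comp)
  next
    case 4
    then obtain f' g' where p: "p = PrimRec f' g'" "code f' = f" "xs = 0 # zs" "y = z"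
      using concl by (cases p) (auto simp: i conclusion_def encode_Pair)
    have "computes f' zs z"
      using 4 by (intro IH) (simp add: i antecedents_def p(2))
    then show ?thesis unfolding p by (rule computes.PrimRec_0)
  next
    case 5
    then obtain f' g' where p: "p = PrimRec f' g'" "code f' = f" "code g' = g"
        "xs = Suc n # zs" "y = z"
      using concl by (cases p) (auto simp: i conclusion_def encode_Pair)
    have "computes (PrimRec f' g') (n # zs) r"
      using 5 by (intro IH) (simp add: i antecedents_def p(2,3))
    moreover have "computes g' (n # r # zs) z"
      using 5 by (intro IH) (simp add: i antecedents_def p(3))
    ultimately show ?thesis
      unfolding p by (rule computes.PrimRec_Suc)
  next
    case 6
    then obtain f' where p: "p = Mu f'" "code f' = f" "xs = zs" "y = length ys"
      using concl by (cases p) (auto simp: i conclusion_def encode_Pair)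
    have "computes f' (y # xs) 0"
      using 6 by (intro IH) (simp add: i antecedents_def p)
    moreover have "computes f' (m # xs) (Suc (lookup 0 ys m))" if "m < y" for m
      using 6 that by (intro IH) (auto simp: i antecedents_def p)
    ultimately show ?thesis unfolding p(1) by (blast intro: computes.Mu)
  next
    case 7
    then have "p = Zero" "y = 0"
      using concl by (cases p; simp add: i conclusion_def encode_Pair)+
    then show ?thesis by (simp add: computes.Zero)
  qed
qed

text \<open>
  Only unary programs are needed in the sequel. The equations with another number of arguments
  are replaced by a true one.
\<close>

definition enum :: "nat \<Rightarrow> nat \<times> nat \<times> nat" where
  "enum t = (case fact_at t of (c, xs, v) \<Rightarrow>
     (case xs of [] \<Rightarrow> (code Zero, 0, 0)
      | u # us \<Rightarrow> if us = [] then (c, u, v) else (code Zero, 0, 0)))"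

lemma computable_enum [computable_intros]:
  assumes "computable t"
  shows "computable (\<lambda>x. enum (t x))"
  by (rule computable_comp[OF _ assms], unfold enum_def)
    (intro computable_intros computable_comp[OF computable_fact_at])

lemma enum_derivable: "enum t = (c, u, v) \<Longrightarrow> derivable (c, [u], v)"
  using derivable_fact_at[of t] derivable_Zero[of "[0]"]
  by (auto simp: enum_def split: prod.splits list.splits if_splits)

lemma enum_sound:
  assumes "\<And>x. computes p [x] (f x)" and "enum t = (code p, u, v)"
  shows "v = f u"
  using derivable_sound[OF enum_derivable[OF assms(2)] refl] assms(1) computes_deterministic by blast

lemma enum_complete:
  assumes "\<And>x. computes p [x] (f x)"
  shows "\<exists>t\<ge>N. enum t = (code p, u, f u)"
proof -
  obtain t where "t \<ge> N" "fact_at t = (code p, [u], f u)"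
    using fact_at_surj[OF derivable_complete[OF assms]] by blast
  then show ?thesis by (auto simp: enum_def)
qed

section \<open>The construction\<close>

text \<open>
  For the requirement \<open>(i, j, e)\<close>, \<open>reach G (i, j, e) x t\<close> is the part of the set \<open>S x\<close>
  that has been found before stage \<open>t\<close>, where \<open>G\<close> is the function \<open>original\<close> that is being
  constructed and \<open>e\<close> is the code of a program for the reduction. At stage \<open>t\<close> only the values
  of \<open>G\<close> below \<open>t\<close> exist, hence the bounds on \<open>u\<close> and \<open>v\<close>. Nothing is lost by them because each
  equation is enumerated again later.
\<close>

primrec reach :: "(nat \<Rightarrow> nat \<Rightarrow> nat) \<Rightarrow> nat \<times> nat \<times> nat \<Rightarrow> nat \<Rightarrow> nat \<Rightarrow> nat list" where
  "reach G r x 0 = [x]"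
| "reach G r x (Suc t) =
    (case r of (i, j, e) \<Rightarrow> case enum t of (c, u, v) \<Rightarrow>
      if c = e \<and> u < t \<and> v < t \<and> G i u \<in> set (reach G r x t)
      then G j v # reach G r x t else reach G r x t)"

definition peak :: "(nat \<Rightarrow> nat \<Rightarrow> nat) \<Rightarrow> nat \<times> nat \<times> nat \<Rightarrow> nat \<Rightarrow> nat \<Rightarrow> nat \<Rightarrow> bool" where
  "peak G r x s y \<longleftrightarrow> y \<in> set (reach G r x s) \<and> (\<forall>z \<in> set (reach G r x s). z \<le> y)"

text \<open>
  Here \<open>ys\<close> contains the claims of the requirements before \<open>r\<close>. The first alternative ensures
  that a claim exists. The resulting claim \<open>s\<close> at stage \<open>s\<close> is a fictitious one: making the
  stage a copy of itself changes nothing, and a fixed number is claimed in this way at one stage only.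
\<close>

definition claimable :: "(nat \<Rightarrow> nat \<Rightarrow> nat) \<Rightarrow> nat \<Rightarrow> nat \<Rightarrow> nat list \<Rightarrow> nat \<Rightarrow> bool" where
  "claimable G s r ys y \<longleftrightarrow> s \<le> y \<or>
     r \<le> y \<and> y \<notin> set ys \<and> (\<exists>x \<in> set [0..<Suc y]. peak G (decode r) x s y)"

primrec claims :: "(nat \<Rightarrow> nat \<Rightarrow> nat) \<Rightarrow> nat \<Rightarrow> nat \<Rightarrow> nat list" where
  "claims G s 0 = []"
| "claims G s (Suc r) = (LEAST y. claimable G s r (claims G s r) y) # claims G s r"

definition claim :: "(nat \<Rightarrow> nat \<Rightarrow> nat) \<Rightarrow> nat \<Rightarrow> nat \<Rightarrow> nat" where
  "claim G s r = (LEAST y. claimable G s r (claims G s r) y)"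

text \<open>
  The stages \<open>(0, b)\<close> provide the copy of \<open>b\<close> known in advance, and the stages \<open>(r + 1, n)\<close> serve
  the requirement \<open>r\<close>. A result \<open>(i, y)\<close> makes the stage, as a number, an \<open>i\<close>-copy of \<open>y\<close>; for
  indices other than \<open>i\<close> it becomes a copy of itself. Accordingly \<open>(0, u)\<close> at stage \<open>u\<close> means that
  nothing is done. With \<open>i = j\<close> the comparison would never come out in favour of stopping, as each
  new copy counts on both sides.
\<close>

definition act :: "(nat \<Rightarrow> nat \<Rightarrow> nat) \<Rightarrow> nat \<Rightarrow> nat \<times> nat" where
  "act G u = (case decode u of (a, n :: nat) \<Rightarrow>
     (case a of 0 \<Rightarrow> (0, u)
      | Suc r \<Rightarrow> (case decode r of (i, j, e :: nat) \<Rightarrow>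
          let y = claim G u r in
          if i \<noteq> j \<and> length (filter (\<lambda>w. G i w = y) [0..<u])
              \<le> length (filter (\<lambda>w. G j w \<le> y) [0..<u])
          then (i, y) else (0, u))))"

definition copy_of :: "nat \<times> nat \<Rightarrow> nat \<Rightarrow> nat \<Rightarrow> nat" where
  "copy_of a k u = (case decode u of (m :: nat, b) \<Rightarrow>
     if m = 0 then b else if k = fst a then snd a else u)"

text \<open>
  The history at stage \<open>u\<close> determines \<open>original\<close> below \<open>u\<close>; the default value beyond it only
  makes the function total.
\<close>

definition from_history :: "(nat \<times> nat) list \<Rightarrow> nat \<Rightarrow> nat \<Rightarrow> nat" where
  "from_history h k u = copy_of (lookup (0, 0) h u) k u"

fun action :: "nat \<Rightarrow> nat \<times> nat" where
  "action u = act (from_history (map action [0..<u])) u"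

declare action.simps [simp del]

definition original :: "nat \<Rightarrow> nat \<Rightarrow> nat" where
  "original k u = copy_of (action u) k u"

section \<open>Computability of the construction\<close>

text \<open>
  The function \<open>G\<close> in the construction varies with the history, so it is treated as a computable
  function with an additional argument.
\<close>

lemma computable_reach [computable_intros]:
  assumes G: "computable (\<lambda>p. G (fst p) (fst (snd p)) (snd (snd p)))"
    and "computable r" and "computable x" and "computable t"
  shows "computable (\<lambda>c. reach (G c) (r c) (x c) (t c))"
proof -
  have "reach F q y s = rec_nat [y] (\<lambda>t l. case q of (i, j, e) \<Rightarrow> case enum t of (c, u, v) \<Rightarrow>
      if c = e \<and> u < t \<and> v < t \<and> F i u \<in> set l then F j v # l else l) s" for F q y s
  proof (induction s)
    case (Suc s)
    show ?case unfolding reach.simps Suc by simp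
  qed simp
  then show ?thesis
    by (simp only:) (intro computable_intros computable_comp3[OF G]
        computable_comp[OF assms(2)] assms(3,4))
qed

lemma decidable_peak [computable_intros]:
  assumes G: "computable (\<lambda>p. G (fst p) (fst (snd p)) (snd (snd p)))"
    and "computable r" and "computable x" and "computable s" and "computable y"
  shows "decidable (\<lambda>c. peak (G c) (r c) (x c) (s c) (y c))"
  unfolding peak_def
  by (intro computable_intros computable_comp3[OF G] assms(2-) computable_comp[OF assms(5)]
      computable_comp[OF assms(4)] computable_comp[OF assms(3)] computable_comp[OF assms(2)])

lemma decidable_claimable [computable_intros]:
  assumes G: "computable (\<lambda>p. G (fst p) (fst (snd p)) (snd (snd p)))"
    and "computable s" and "computable r" and "computable ys" and "computable y"
  shows "decidable (\<lambda>c. claimable (G c) (s c) (r c) (ys c) (y c))"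
  unfolding claimable_def
  by (intro computable_intros computable_comp3[OF G] assms(2-) computable_comp[OF assms(5)]
      computable_comp[OF assms(4)] computable_comp[OF assms(3)] computable_comp[OF assms(2)])

lemma ex_claimable: "\<exists>y. claimable G s r ys y"
  by (auto simp: claimable_def)

lemma computable_claims [computable_intros]:
  assumes G: "computable (\<lambda>p. G (fst p) (fst (snd p)) (snd (snd p)))"
    and "computable s" and "computable r"
  shows "computable (\<lambda>c. claims (G c) (s c) (r c))"
proof -
  have "claims F q n = rec_nat [] (\<lambda>r ys. (LEAST y. claimable F q r ys y) # ys) n" for F q n
    by (induction n) simp_all
  then show ?thesis
    by (simp only:) (intro computable_intros ex_claimable computable_comp3[OF G]
        computable_comp[OF assms(2)] assms(2-))
qed

lemma computable_claim [computable_intros]: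
  assumes G: "computable (\<lambda>p. G (fst p) (fst (snd p)) (snd (snd p)))"
    and "computable s" and "computable r"
  shows "computable (\<lambda>c. claim (G c) (s c) (r c))"
  unfolding claim_def
  by (intro computable_intros ex_claimable computable_comp3[OF G]
      computable_comp[OF assms(2)] computable_comp[OF assms(3)])

lemma computable_act [computable_intros]:
  assumes G: "computable (\<lambda>p. G (fst p) (fst (snd p)) (snd (snd p)))"
    and "computable u"
  shows "computable (\<lambda>c. act (G c) (u c))"
  unfolding act_def
  by (intro computable_intros computable_comp3[OF G] computable_comp[OF assms(2)] assms(2))

lemma computable_copy_of [computable_intros]:
  assumes "computable a" and "computable k" and "computable u"
  shows "computable (\<lambda>x. copy_of (a x) (k x) (u x))"
  unfolding copy_of_def by (intro computable_intros assms)

lemma computable_action: "computable action"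
proof (rule computable_course_of_values)
  show "computable (\<lambda>h. act (from_history h) (length h))"
    unfolding from_history_def by (intro computable_intros)
  show "action n = act (from_history (map action [0..<n])) (length (map action [0..<n]))" for n
    by (subst action.simps) simp
qed

lemma computable_original [computable_intros]:
  assumes "computable k" and "computable u"
  shows "computable (\<lambda>x. original (k x) (u x))"
  unfolding original_def by (intro computable_intros computable_comp[OF computable_action] assms)

section \<open>Properties that are eventually constant\<close>

text \<open>
  Limits of the construction need not be computable, but whatever it says about a fixed number
  changes only finitely often. Properties of stages with this behaviour are closed under Boolean
  operations and quantification over finite sets.
\<close>

definition settles :: "(nat \<Rightarrow> bool) \<Rightarrow> bool" where
  "settles P \<longleftrightarrow> (\<forall>\<^sub>F s in sequentially. P s) \<or> (\<forall>\<^sub>F s in sequentially. \<not> P s)"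

lemma settles_not: "settles P \<Longrightarrow> settles (\<lambda>s. \<not> P s)"
  by (auto simp: settles_def)

lemma settles_cases [consumes 1]:
  assumes "settles P"
  obtains "\<forall>\<^sub>F s in sequentially. P s" | "\<forall>\<^sub>F s in sequentially. \<not> P s"
  using assms unfolding settles_def by blast

lemma settles_conj:
  assumes "settles P" and "settles Q"
  shows "settles (\<lambda>s. P s \<and> Q s)"
  using assms(1)
proof (cases rule: settles_cases)
  case 1
  from assms(2) show ?thesis
  proof (cases rule: settles_cases)
    case 1
    with \<open>\<forall>\<^sub>F s in sequentially. P s\<close> show ?thesis
      by (simp add: settles_def eventually_conj)
  next
    case 2
    then have "\<forall>\<^sub>F s in sequentially. \<not> (P s \<and> Q s)" by eventually_elim simp
    then show ?thesis by (simp add: settles_def)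
  qed
next
  case 2
  then have "\<forall>\<^sub>F s in sequentially. \<not> (P s \<and> Q s)" by eventually_elim simp
  then show ?thesis by (simp add: settles_def)
qed

lemma settles_disj: "settles P \<Longrightarrow> settles Q \<Longrightarrow> settles (\<lambda>s. P s \<or> Q s)"
  using settles_not[OF settles_conj[OF settles_not settles_not], of P Q] by simp

lemma settles_const: "settles (\<lambda>s. c)"
  by (cases c) (auto simp: settles_def)

lemma settles_Ball:
  assumes "finite X" and "\<And>x. x \<in> X \<Longrightarrow> settles (P x)"
  shows "settles (\<lambda>s. \<forall>x \<in> X. P x s)"
  using assms by (induction X) (simp_all add: settles_const settles_conj)

lemma settles_Bex:
  assumes "finite X" and "\<And>x. x \<in> X \<Longrightarrow> settles (P x)"
  shows "settles (\<lambda>s. \<exists>x \<in> X. P x s)"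
  using settles_not[OF settles_Ball[OF assms(1) settles_not[OF assms(2)]]] by simp

lemma settles_mono_eq:
  assumes "mono (f :: nat \<Rightarrow> nat)"
  shows "settles (\<lambda>s. f s = y)"
proof -
  consider s where "y < f s" | s where "f s = y" "\<And>t. f t \<le> y" | "\<And>s. f s \<noteq> y"
    by (metis not_le)
  then show ?thesis
  proof cases
    case 1
    then have "\<forall>t\<ge>s. f t \<noteq> y"
      using monoD[OF assms] by (metis leD)
    then show ?thesis unfolding settles_def eventually_sequentially by blast
  next
    case 2
    then have "\<forall>t\<ge>s. f t = y"
      using monoD[OF assms] by (metis order_antisym)
    then show ?thesis unfolding settles_def eventually_sequentially by blast
  qed (simp add: settles_def)
qed

lemma finite_at_most_one_eventually:
  fixes f :: "nat \<Rightarrow> 'a"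
  shows "finite {y. \<forall>\<^sub>F s in sequentially. f s = y}"
proof (cases "\<exists>y. \<forall>\<^sub>F s in sequentially. f s = y")
  case True
  then obtain y where y: "\<forall>\<^sub>F s in sequentially. f s = y" by blast
  have "z = y" if "\<forall>\<^sub>F s in sequentially. f s = z" for z
  proof -
    from y that have "\<forall>\<^sub>F s in sequentially. z = y" by eventually_elim simp
    then show ?thesis by simp
  qed
  then have "{y. \<forall>\<^sub>F s in sequentially. f s = y} \<subseteq> {y}" by blast
  then show ?thesis by (rule finite_subset) simp
qed simp

section \<open>Monotonicity and locality of the construction\<close>

lemma reach_mono:
  assumes "s \<le> t"
  shows "set (reach G r x s) \<subseteq> set (reach G r x t)"
proof (rule lift_Suc_mono_le[OF _ assms])
  show "set (reach G r x n) \<subseteq> set (reach G r x (Suc n))" for n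
    by (auto simp: split_beta)
qed

lemma reach_start: "x \<in> set (reach G r x s)"
  using reach_mono[of 0 s G r x] by auto

lemma peak_iff_Max: "peak G r x s y \<longleftrightarrow> Max (set (reach G r x s)) = y"
  unfolding peak_def using reach_start[of x G r s]
  by (metis List.finite_set Max_eqI Max_ge Max_in emptyE)

text \<open>
  The set reached from \<open>x\<close> grows, so its maximum passes each number at most once.
\<close>

lemma settles_peak: "settles (\<lambda>s. peak G r x s y)"
proof -
  have "mono (\<lambda>s. Max (set (reach G r x s)))"
  proof (rule monoI)
    fix s t :: nat assume "s \<le> t"
    then show "Max (set (reach G r x s)) \<le> Max (set (reach G r x t))"
      using reach_mono[OF \<open>s \<le> t\<close>, of G r x] reach_start[of x G r s]
      by (intro Max_mono) (blast, metis empty_iff, simp)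
  qed
  then show ?thesis
    unfolding peak_iff_Max by (rule settles_mono_eq)
qed

lemma reach_cong:
  assumes "\<And>k w. w < t \<Longrightarrow> G k w = H k w"
  shows "reach G r x t = reach H r x t"
  using assms by (induction t) (auto split: prod.split)

lemma peak_cong:
  assumes "\<And>k w. w < s \<Longrightarrow> G k w = H k w"
  shows "peak G r x s y \<longleftrightarrow> peak H r x s y"
  using reach_cong[OF assms] by (simp add: peak_def)

lemma claimable_cong:
  assumes "\<And>k w. w < s \<Longrightarrow> G k w = H k w"
  shows "claimable G s r ys y \<longleftrightarrow> claimable H s r ys y"
  using peak_cong[OF assms] by (simp add: claimable_def)

lemma claims_cong:
  assumes "\<And>k w. w < s \<Longrightarrow> G k w = H k w"
  shows "claims G s r = claims H s r"
  by (induction r) (simp_all add: claimable_cong[OF assms])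

lemma claim_cong:
  assumes "\<And>k w. w < s \<Longrightarrow> G k w = H k w"
  shows "claim G s r = claim H s r"
  by (simp add: claim_def claims_cong[OF assms] claimable_cong[OF assms])

text \<open>
  A stage \<open>u\<close> only looks at copies below \<open>u\<close>. This is what allows replacing the history by the
  function \<open>original\<close> itself.
\<close>

lemma act_cong:
  assumes "\<And>k w. w < u \<Longrightarrow> G k w = H k w"
  shows "act G u = act H u"
proof -
  have eq: "filter (\<lambda>w. G k w = y) [0..<u] = filter (\<lambda>w. H k w = y) [0..<u]"
    and le: "filter (\<lambda>w. G k w \<le> y) [0..<u] = filter (\<lambda>w. H k w \<le> y) [0..<u]" for k y
    using assms by (auto intro: filter_cong)
  have claim: "claim G u r = claim H u r" for r
    by (rule claim_cong) (rule assms)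
  show ?thesis
    unfolding act_def claim eq le by (rule refl)
qed

lemma action_eq: "action u = act original u"
proof -
  have "from_history (map action [0..<u]) k w = original k w" if "w < u" for k w
    using that by (simp add: from_history_def original_def lookup_def)
  then show ?thesis
    by (subst action.simps) (rule act_cong)
qed

section \<open>Convergence of claims\<close>

lemma set_claims: "set (claims G s r) = claim G s ` {..<r}"
  by (induction r) (auto simp: claim_def lessThan_Suc)

lemma claimable_claim: "claimable G s r (claims G s r) (claim G s r)"
  unfolding claim_def by (rule LeastI_ex) (rule ex_claimable)

lemma claim_least: "y < claim G s r \<Longrightarrow> \<not> claimable G s r (claims G s r) y"
  unfolding claim_def by (rule not_less_Least)

lemma claim_eq_iff:
  "claim G s r = y \<longleftrightarrow> claimable G s r (claims G s r) y \<and>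
    (\<forall>z<y. \<not> claimable G s r (claims G s r) z)"
  using claimable_claim[of G s r] claim_least[of _ G s r] by (metis linorder_neqE_nat)

lemma settles_claimable:
  assumes "\<And>q. q < r \<Longrightarrow> settles (\<lambda>s. claim G s q = y)"
  shows "settles (\<lambda>s. claimable G s r (claims G s r) y)"
proof -
  have "\<forall>\<^sub>F s in sequentially. \<not> s \<le> y"
    using eventually_gt_at_top[of y] by (simp add: not_le)
  then have "settles (\<lambda>s. s \<le> y)" by (simp add: settles_def)
  moreover have "settles (\<lambda>s. \<exists>q \<in> {..<r}. claim G s q = y)"
    using assms by (intro settles_Bex) auto
  moreover have "settles (\<lambda>s. \<exists>x \<in> set [0..<Suc y]. peak G (decode r) x s y)"
    by (intro settles_Bex settles_peak) simp
  moreover have "y \<notin> set (claims G s r) \<longleftrightarrow> \<not> (\<exists>q \<in> {..<r}. claim G s q = y)" for s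
    by (auto simp: set_claims)
  ultimately show ?thesis
    unfolding claimable_def by (simp only: settles_disj settles_conj settles_not settles_const)
qed

text \<open>
  Whether \<open>y\<close> is claimable for \<open>r\<close> depends on the claims of earlier requirements and on whether
  \<open>y\<close> is the maximum of the set reached from some \<open>x\<close>. As \<open>x\<close> belongs to this set, only the
  finitely many \<open>x \<le> y\<close> matter.
\<close>

lemma settles_claim: "settles (\<lambda>s. claim G s r = y)"
proof (induction r arbitrary: y rule: less_induct)
  case (less r)
  have "settles (\<lambda>s. \<forall>z \<in> {..<y}. \<not> claimable G s r (claims G s r) z)"
    by (intro settles_Ball settles_not settles_claimable less) auto
  then show ?case
    unfolding claim_eq_iff
    using settles_conj[OF settles_claimable[OF less]] by (simp add: Ball_def)
qed

lemma claim_inj: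
  assumes "claim G s q = y" and "claim G s r = y" and "y < s"
  shows "q = r"
proof -
  have False if "q < r" "claim G s q = y" "claim G s r = y" for q r
    using that claimable_claim[of G s r] \<open>y < s\<close>
    by (auto simp: claimable_def set_claims)
  then show ?thesis using assms by (metis linorder_neqE_nat)
qed

lemma claim_ge: "claim G s r < s \<Longrightarrow> r \<le> claim G s r"
  using claimable_claim[of G s r] by (auto simp: claimable_def)

section \<open>Every number has finitely many copies\<close>

lemma length_filter_upt: "length (filter P [0..<u]) = card {w. w < u \<and> P w}"
proof -
  have "length (filter P [0..<u]) = card (set (filter P [0..<u]))"
    by (rule distinct_card[symmetric]) simp
  also have "set (filter P [0..<u]) = {w. w < u \<and> P w}" by auto
  finally show ?thesis .
qed

lemma original_0: "original k (encode (0::nat, b::nat)) = b"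
  by (simp add: original_def copy_of_def)

lemma original_requirement:
  assumes u: "u = encode (Suc r, n :: nat)" and r: "decode r = (i :: nat, j :: nat, e :: nat)"
    and y: "y = claim original u r"
  shows "original k u = (if k = i \<and> i \<noteq> j \<and>
    card {w. w < u \<and> original i w = y} \<le> card {w. w < u \<and> original j w \<le> y} then y else u)"
proof -
  have "action u = (if i \<noteq> j \<and>
      card {w. w < u \<and> original i w = y} \<le> card {w. w < u \<and> original j w \<le> y}
      then (i, y) else (0, u))"
    unfolding action_eq act_def by (simp add: u r y length_filter_upt)
  moreover have "original k u = (if k = fst (action u) then snd (action u) else u)"
    by (simp add: original_def copy_of_def u)
  ultimately show ?thesis by simp
qed

lemma original_cases:
  assumes "original k u = y" and "u \<noteq> encode (0::nat, y)" and "u \<noteq> y"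
  obtains r n j e where "u = encode (Suc r, n :: nat)" and "decode r = (k, j, e :: nat)" and "k \<noteq> j"
    and "claim original u r = y"
    and "card {w. w < u \<and> original k w = y} \<le> card {w. w < u \<and> original j w \<le> y}"
proof -
  obtain a n where u: "u = encode (a :: nat, n :: nat)"
    by (metis encode_decode surj_pair)
  have "a \<noteq> 0"
    using assms(1,2) original_0[of k n] by (metis u)
  then obtain r where a: "a = Suc r" using not0_implies_Suc by blast
  obtain i j e where r: "decode r = (i :: nat, j :: nat, e :: nat)" by (metis surj_pair)
  have "k = i \<and> i \<noteq> j \<and> claim original u r = y \<and>
      card {w. w < u \<and> original i w = y} \<le> card {w. w < u \<and> original j w \<le> y}"
    using original_requirement[OF _ r refl, of u n k] assms(1,3) u a by (auto split: if_splits)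
  then show ?thesis using that u a r by blast
qed

text \<open>
  Assume this for all numbers below \<open>y\<close>. Late copies of \<open>y\<close> can only be made by a requirement
  \<open>r \<le> y\<close> that claims \<open>y\<close>, and by \<open>settles_claim\<close> and \<open>claim_inj\<close> this is always the same one.
  Let \<open>r\<close> be the requirement \<open>(i, j, e)\<close>. Then \<open>y\<close> gets no more \<open>j\<close>-copies because \<open>j \<noteq> i\<close>, and
  the smaller numbers get none by the induction hypothesis. So the number of \<open>j\<close>-copies with
  which \<open>r\<close> compares is bounded, and after finitely many new \<open>i\<close>-copies of \<open>y\<close> the requirement
  is content.
\<close>

lemma original_eventually_avoids: "\<forall>\<^sub>F u in sequentially. \<forall>k. original k u \<noteq> y"
proof (induction y rule: less_induct)
  case (less y)
  define owner where "owner r \<longleftrightarrow> (\<forall>\<^sub>F s in sequentially. claim original s r = y)" for r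
  define full where "full i j u \<longleftrightarrow>
    card {w. w < u \<and> original i w = y} \<le> card {w. w < u \<and> original j w \<le> y}" for i j u
  have "\<forall>\<^sub>F s in sequentially. \<forall>r \<in> {..y}. claim original s r = y \<longrightarrow> owner r"
  proof (intro eventually_ball_finite ballI)
    fix r
    from settles_claim[of original r y]
    show "\<forall>\<^sub>F s in sequentially. claim original s r = y \<longrightarrow> owner r"
    proof (cases rule: settles_cases)
      case 1
      then show ?thesis by (simp add: owner_def)
    next
      case 2
      then show ?thesis by eventually_elim simp
    qed
  qed simp
  moreover have "\<forall>\<^sub>F s in sequentially. \<forall>r \<in> {r. r \<le> y \<and> owner r}. claim original s r = y"
    by (rule eventually_ball_finite) (auto simp: owner_def)
  moreover have "\<forall>\<^sub>F u in sequentially. encode (0::nat, y) < u \<and> y < u"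
    by (intro eventually_conj eventually_gt_at_top)
  ultimately have copied: "\<forall>\<^sub>F u in sequentially. \<forall>k. original k u = y \<longrightarrow>
    (\<exists>r j e. r \<le> y \<and> owner r \<and> (\<forall>q. q \<le> y \<and> owner q \<longrightarrow> q = r) \<and>
      decode r = (k, j, e :: nat) \<and> k \<noteq> j \<and> full k j u)"
  proof eventually_elim
    case (elim u)
    show ?case
    proof (intro allI impI)
      fix k assume "original k u = y"
      then obtain r j e where r: "decode r = (k, j, e :: nat)" "k \<noteq> j"
        and claim: "claim original u r = y" and full: "full k j u"
        using elim(3) unfolding full_def by (elim original_cases) auto
      have "r \<le> y"
        using claim_ge[of original u r] claim elim(3) by simp
      moreover have "owner r"
        using elim(1) claim \<open>r \<le> y\<close> by blast
      moreover have "q = r" if "q \<le> y" "owner q" for q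
      proof (rule claim_inj)
        show "claim original u q = y" using elim(2) that by blast
        show "claim original u r = y" by (rule claim)
        show "y < u" using elim(3) by blast
      qed
      ultimately show "\<exists>r j e. r \<le> y \<and> owner r \<and> (\<forall>q. q \<le> y \<and> owner q \<longrightarrow> q = r) \<and>
          decode r = (k, j, e :: nat) \<and> k \<noteq> j \<and> full k j u"
        using r full by blast
    qed
  qed
  show ?case
  proof (cases "\<exists>r\<le>y. owner r")
    case False
    from copied show ?thesis
      by eventually_elim (use False in blast)
  next
    case True
    then obtain r where r: "r \<le> y" "owner r" by blast
    obtain i j e where d: "decode r = (i :: nat, j :: nat, e :: nat)" by (metis surj_pair)
    have only: "\<forall>\<^sub>F u in sequentially. \<forall>k. original k u = y \<longrightarrow> k = i \<and> i \<noteq> j \<and> full i j u"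
      using copied
    proof eventually_elim
      case (elim u)
      show ?case
      proof (intro allI impI)
        fix k assume "original k u = y"
        with elim obtain r' j' e' where r': "\<forall>q. q \<le> y \<and> owner q \<longrightarrow> q = r'"
          and d': "decode r' = (k, j', e' :: nat)" and "k \<noteq> j'" "full k j' u"
          by blast
        moreover have "r' = r" using r r' by blast
        ultimately show "k = i \<and> i \<noteq> j \<and> full i j u" using d by simp
      qed
    qed
    have "\<forall>\<^sub>F u in sequentially. \<forall>z \<in> {..<y}. \<forall>k. original k u \<noteq> z"
      by (intro eventually_ball_finite) (simp_all add: less)
    with only have "\<forall>\<^sub>F u in sequentially. i \<noteq> j \<longrightarrow> \<not> original j u \<le> y"
    proof eventually_elim
      case (elim u)
      then show ?case by (metis lessThan_iff order_le_less)
    qed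
    then obtain N where N: "\<And>u. u \<ge> N \<Longrightarrow> i \<noteq> j \<Longrightarrow> \<not> original j u \<le> y"
      unfolding eventually_sequentially by blast
    have "finite {u. original i u = y}"
    proof (rule ccontr)
      assume inf: "infinite {u. original i u = y}"
      obtain F where F: "F \<subseteq> {u. original i u = y}" "finite F" "card F = Suc N"
        using infinite_arbitrarily_large[OF inf] by blast
      have "\<forall>\<^sub>F u in sequentially. \<forall>w \<in> F. w < u"
        using F(2) by (intro eventually_ball_finite) (auto intro: eventually_gt_at_top)
      with only have "\<forall>\<^sub>F u in sequentially. original i u \<noteq> y"
      proof eventually_elim
        case (elim u)
        show ?case
        proof
          assume "original i u = y"
          then have "i \<noteq> j" and "full i j u"
            using elim(1) by blast+
          have "F \<subseteq> {w. w < u \<and> original i w = y}"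
            using F elim(2) by blast
          then have "card F \<le> card {w. w < u \<and> original i w = y}"
            by (intro card_mono) auto
          moreover have "{w. w < u \<and> original j w \<le> y} \<subseteq> {..<N}"
            using N \<open>i \<noteq> j\<close> not_le by blast
          then have "card {w. w < u \<and> original j w \<le> y} \<le> N"
            by (metis card_lessThan card_mono finite_lessThan)
          ultimately show False using \<open>full i j u\<close> F(3) by (simp add: full_def)
        qed
      qed
      then obtain M where "\<And>u. u \<ge> M \<Longrightarrow> original i u \<noteq> y"
        unfolding eventually_sequentially by blast
      then have "{u. original i u = y} \<subseteq> {..<M}"
        using not_le by blast
      with inf show False using finite_subset by blast
    qed
    then obtain M where M: "\<And>u. original i u = y \<Longrightarrow> u < M"
      by (auto simp: finite_nat_set_iff_bounded)
    from only eventually_ge_at_top[of M] show ?thesis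
    proof eventually_elim
      case (elim u)
      then show ?case using M not_le by blast
    qed
  qed
qed

lemma finite_copies: "finite {u. original k u = y}"
proof -
  obtain M where "\<And>u. u \<ge> M \<Longrightarrow> original k u \<noteq> y"
    using original_eventually_avoids[of y] unfolding eventually_sequentially by blast
  then have "{u. original k u = y} \<subseteq> {..<M}"
    using not_le by blast
  then show ?thesis using finite_subset by blast
qed

section \<open>One-one reductions between the copied sets\<close>

text \<open>
  Each step replaces the original of \<open>u\<close> by the original of \<open>f u\<close>, and these agree about
  membership in \<open>A\<close> because \<open>f\<close> is a reduction.
\<close>

lemma reach_homogeneous:
  assumes p: "\<And>x. computes p [x] (f x)"
    and f: "\<And>u. original i u \<in> A \<longleftrightarrow> original j (f u) \<in> A"
    and "y \<in> set (reach original (i, j, code p) x s)"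
  shows "y \<in> A \<longleftrightarrow> x \<in> A"
  using assms(3)
proof (induction s arbitrary: y)
  case (Suc s)
  obtain c u v where t: "enum s = (c, u, v)" by (metis surj_pair)
  then have "v = f u" if "c = code p"
    using enum_sound[OF p] that by blast
  then show ?case
    using Suc f[of u] t by (auto split: if_splits)
qed simp

lemma reach_closed:
  assumes p: "\<And>x. computes p [x] (f x)"
    and "original i u \<in> set (reach original (i, j, code p) x s)"
  shows "\<exists>t. original j (f u) \<in> set (reach original (i, j, code p) x t)"
proof -
  obtain t where t: "t \<ge> Suc (s + u + f u)" "enum t = (code p, u, f u)"
    using enum_complete[OF p] by blast
  then have "s \<le> t" by simp
  then have "original i u \<in> set (reach original (i, j, code p) x t)"
    using assms(2) reach_mono by blast
  then have "original j (f u) \<in> set (reach original (i, j, code p) x (Suc t))"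
    using t by simp
  then show ?thesis by blast
qed

lemma eventually_peak_Max:
  assumes "finite (\<Union>s. set (reach G r x s))"
  shows "\<forall>\<^sub>F s in sequentially. peak G r x s (Max (\<Union>s. set (reach G r x s)))"
proof -
  let ?S = "\<Union>s. set (reach G r x s)"
  have "Max ?S \<in> ?S"
    using reach_start[of x G r] by (intro Max_in assms) blast
  then obtain s where s: "Max ?S \<in> set (reach G r x s)" by blast
  have "peak G r x t (Max ?S)" if "t \<ge> s" for t
    unfolding peak_def
    using s reach_mono[OF that, of G r x] Max_ge[OF assms] by blast
  then show ?thesis unfolding eventually_sequentially by blast
qed

text \<open>
  Only finitely many numbers are claimed in the long run by earlier requirements, whereas the
  maxima of the finite sets are unbounded since each \<open>x\<close> lies in its own set. So some maximum is
  eventually claimable, and the claims converge to the least number of this kind. This number is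
  the maximum of the set of one particular \<open>x\<close> from some stage on, because finitely many \<open>x\<close>
  come into question.
\<close>

lemma claim_converges:
  assumes "infinite {x. finite (\<Union>s. set (reach G (decode r) x s))}"
  obtains y x where "\<forall>\<^sub>F s in sequentially. claim G s r = y"
    and "\<forall>\<^sub>F s in sequentially. peak G (decode r) x s y"
proof -
  let ?Q = "\<lambda>y s. claimable G s r (claims G s r) y"
  define C where "C = (\<Union>q \<in> {..<r}. {y. \<forall>\<^sub>F s in sequentially. claim G s q = y})"
  have "finite C"
    unfolding C_def by (intro finite_UN_I finite_at_most_one_eventually) simp
  then have "finite (insert r C)" by simp
  then obtain b where b: "\<And>z. z \<in> insert r C \<Longrightarrow> z < b"
    unfolding finite_nat_set_iff_bounded by blast
  have "infinite ({x. finite (\<Union>s. set (reach G (decode r) x s))} - {..<b})"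
    using assms by simp
  then obtain x where fin: "finite (\<Union>s. set (reach G (decode r) x s))" and "x \<ge> b"
    using infinite_imp_nonempty by (metis (mono_tags, lifting) DiffE ex_in_conv lessThan_iff
        mem_Collect_eq not_le)
  have x: "z < x" if "z \<in> insert r C" for z
    using b[OF that] \<open>x \<ge> b\<close> by simp
  define y where "y = Max (\<Union>s. set (reach G (decode r) x s))"
  have "x \<le> y"
    unfolding y_def using reach_start[of x G "decode r"] by (intro Max_ge fin) blast
  have "\<forall>\<^sub>F s in sequentially. \<forall>q \<in> {..<r}. claim G s q \<noteq> y"
  proof (intro eventually_ball_finite ballI)
    fix q assume "q \<in> {..<r}"
    then have "\<not> (\<forall>\<^sub>F s in sequentially. claim G s q = y)"
      using x[of y] \<open>x \<le> y\<close> by (auto simp: C_def)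
    then show "\<forall>\<^sub>F s in sequentially. claim G s q \<noteq> y"
      using settles_claim[of G q y] by (auto simp: settles_def)
  qed simp
  with eventually_peak_Max[OF fin] have "\<forall>\<^sub>F s in sequentially. ?Q y s"
  proof eventually_elim
    case (elim s)
    have "x \<in> set [0..<Suc y]" using \<open>x \<le> y\<close> by (simp del: upt_Suc)
    moreover have "peak G (decode r) x s y" using elim(1) by (simp add: y_def)
    moreover have "y \<notin> set (claims G s r)" using elim(2) by (auto simp: set_claims)
    moreover have "r \<le> y" using x[of r] \<open>x \<le> y\<close> by simp
    ultimately show ?case unfolding claimable_def by blast
  qed
  then obtain z where z: "\<forall>\<^sub>F s in sequentially. ?Q z s"
    and least: "\<And>z'. z' < z \<Longrightarrow> \<not> (\<forall>\<^sub>F s in sequentially. ?Q z' s)"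
    using exists_least_iff[of "\<lambda>y. \<forall>\<^sub>F s in sequentially. ?Q y s"] by blast
  have "\<forall>\<^sub>F s in sequentially. \<forall>z' \<in> {..<z}. \<not> ?Q z' s"
  proof (intro eventually_ball_finite ballI)
    fix z' assume "z' \<in> {..<z}"
    then show "\<forall>\<^sub>F s in sequentially. \<not> ?Q z' s"
      using least[of z'] settles_claimable[OF settles_claim, of G r z'] by (auto simp: settles_def)
  qed simp
  with z have claim: "\<forall>\<^sub>F s in sequentially. claim G s r = z"
    by eventually_elim (simp add: claim_eq_iff)
  have "\<exists>x. \<forall>\<^sub>F s in sequentially. peak G (decode r) x s z"
  proof (rule ccontr)
    assume "\<not> ?thesis"
    then have "\<forall>\<^sub>F s in sequentially. \<forall>x \<in> set [0..<Suc z]. \<not> peak G (decode r) x s z"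
      using settles_peak[of G "decode r" _ z]
      by (intro eventually_ball_finite) (auto simp: settles_def)
    with z eventually_gt_at_top[of z] have "\<forall>\<^sub>F s in sequentially. False"
    proof eventually_elim
      case (elim s)
      then show ?case unfolding claimable_def by auto
    qed
    then show False by simp
  qed
  with claim that show ?thesis by blast
qed

text \<open>
  Otherwise the claims converge to the maximum \<open>y\<close> of a finite set that is closed under passing
  from copies along \<open>f\<close>. As \<open>f\<close> is injective, there are at most as many \<open>i\<close>-copies of \<open>y\<close> as
  \<open>j\<close>-copies of numbers up to \<open>y\<close>. Both are finite in number, so late stages see all those
  \<open>j\<close>-copies and find that the requirement wants another \<open>i\<close>-copy of \<open>y\<close>, which it gets
  infinitely often. This contradicts \<open>original_eventually_avoids\<close>.
\<close>

lemma finite_reach_exceptional: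
  assumes p: "\<And>x. computes p [x] (f x)" and "inj f" and "i \<noteq> j"
  shows "finite {x. finite (\<Union>s. set (reach original (i, j, code p) x s))}"
proof (rule ccontr)
  define r where "r = encode (i, j, code p)"
  have r: "decode r = (i, j, code p)" by (simp add: r_def)
  assume "infinite {x. finite (\<Union>s. set (reach original (i, j, code p) x s))}"
  then obtain y x where claim: "\<forall>\<^sub>F s in sequentially. claim original s r = y"
    and "\<forall>\<^sub>F s in sequentially. peak original (i, j, code p) x s y"
    using claim_converges[of original r] r by metis
  then obtain N where peak: "\<And>s. s \<ge> N \<Longrightarrow> peak original (i, j, code p) x s y"
    unfolding eventually_sequentially by blast
  let ?S = "\<Union>s. set (reach original (i, j, code p) x s)"
  have "y \<in> ?S" using peak[of N] by (auto simp: peak_def)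
  have le: "z \<le> y" if "z \<in> ?S" for z
  proof -
    from that obtain s where "z \<in> set (reach original (i, j, code p) x s)" by blast
    then have "z \<in> set (reach original (i, j, code p) x (max s N))"
      using reach_mono[OF max.cobounded1] by blast
    then show ?thesis using peak[of "max s N"] by (simp add: peak_def)
  qed
  let ?X = "{w. original i w = y}" and ?Y = "{w. original j w \<le> y}"
  have "?Y = (\<Union>z \<in> {..y}. {w. original j w = z})" by auto
  then have finY: "finite ?Y" by (simp add: finite_copies)
  have "f ` ?X \<subseteq> ?Y"
  proof
    fix v assume "v \<in> f ` ?X"
    then obtain w where w: "v = f w" "original i w = y" by blast
    have "original j (f w) \<in> ?S"
      using reach_closed[OF p, of i w j x] \<open>y \<in> ?S\<close> w(2) by blast
    then show "v \<in> ?Y" using le w(1) by simp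
  qed
  then have card: "card ?X \<le> card ?Y"
    using \<open>inj f\<close> finY by (meson card_inj_on_le inj_on_subset subset_UNIV)
  have "\<forall>\<^sub>F u in sequentially. \<forall>w \<in> ?Y. w < u"
    using finY by (intro eventually_ball_finite) (auto intro: eventually_gt_at_top)
  with claim original_eventually_avoids[of y]
  have "\<forall>\<^sub>F u in sequentially. \<forall>n. u \<noteq> encode (Suc r, n :: nat)"
  proof eventually_elim
    case (elim u)
    have "card {w. w < u \<and> original i w = y} \<le> card ?X"
      by (intro card_mono finite_copies) auto
    also have "?Y = {w. w < u \<and> original j w \<le> y}"
      using elim(3) by blast
    with card have "card ?X \<le> card {w. w < u \<and> original j w \<le> y}" by simp
    finally show ?case
      using original_requirement[OF _ r, of u _ y i] elim(1,2) \<open>i \<noteq> j\<close> by auto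
  qed
  then obtain M where "\<And>u n. u \<ge> M \<Longrightarrow> u \<noteq> encode (Suc r, n :: nat)"
    unfolding eventually_sequentially by blast
  moreover have "M \<le> encode (Suc r, M)"
    using le_prod_encode_2 by (simp add: encode_Pair)
  ultimately show False by blast
qed

section \<open>Greatest one-one degrees\<close>

text \<open>
  A criterion in the spirit of Young's characterisation of cylinders: if from almost every \<open>x\<close>
  infinitely many numbers can be enumerated that are in \<open>A\<close> if and only if \<open>x\<close> is, then a
  many-one reduction \<open>h\<close> to \<open>A\<close> can be made injective by choosing for \<open>n\<close> a number that is
  enumerated from \<open>h n\<close> and is not among the earlier values. If \<open>h n\<close> is one of the finitely many
  exceptions, a fixed number on the same side of \<open>A\<close> takes its place. One exists on either side
  because \<open>A\<close> and its complement are infinite.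
\<close>

lemma greatest_if_infinite_classes:
  fixes L :: "nat \<Rightarrow> nat \<Rightarrow> nat list"
  assumes L: "computable (\<lambda>p. L (fst p) (snd p))"
    and homogeneous: "\<And>x s y. y \<in> set (L x s) \<Longrightarrow> y \<in> A \<longleftrightarrow> x \<in> A"
    and rare: "finite {x. finite (\<Union>s. set (L x s))}"
    and "infinite A" and "infinite (- A)"
  shows "in_greatest_one_one_degree A"
  unfolding in_greatest_one_one_degree_def
proof
  let ?E = "{x. finite (\<Union>s. set (L x s))}"
  fix C assume "C \<in> many_one_degree A"
  then obtain h where h: "total_recursive h" "\<And>x. x \<in> C \<longleftrightarrow> h x \<in> A"
    unfolding many_one_degree_def many_one_equivalent_def many_one_reducible_def
      many_one_reduction_def by blast
  obtain a where a: "a \<in> A" "a \<notin> ?E"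
    using rare \<open>infinite A\<close> by (meson finite_subset subsetI)
  obtain b where b: "b \<notin> A" "b \<notin> ?E"
    using rare \<open>infinite (- A)\<close> by (metis ComplD finite_subset subsetI)
  \<comment> \<open>The exceptional numbers are finitely many, so that a program can know them and which of them
    belong to \<open>A\<close>. They are replaced by the regular numbers \<open>a\<close> and \<open>b\<close>.\<close>
  obtain EA EB where E: "set EA = ?E \<inter> A" "set EB = ?E - A"
    using finite_list[of "?E \<inter> A"] finite_list[of "?E - A"] rare by auto
  define h' where "h' x = (if h x \<in> set EA then a else if h x \<in> set EB then b else h x)" for x
  have "computable h"
    using h(1) by (simp add: computable_nat_iff)
  then have h': "computable h'"
    unfolding h'_def by (intro computable_intros)
  have h'_A: "h' x \<in> A \<longleftrightarrow> x \<in> C" for x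
    using a b E h(2) by (auto simp: h'_def)
  have "h' x \<notin> ?E" for x
    using a(2) b(2) E unfolding h'_def by auto
  then have inf: "infinite (\<Union>s. set (L (h' x) s))" for x by blast
  \<comment> \<open>Given the list \<open>ys\<close> of the earlier values, \<open>z\<close> codes a stage and a fresh number that
    is enumerated by this stage.\<close>
  define good where "good ys z \<longleftrightarrow> snd (decode z :: nat \<times> nat) \<notin> set ys \<and>
      snd (decode z :: nat \<times> nat) \<in> set (L (h' (length ys)) (fst (decode z :: nat \<times> nat)))" for ys z
  define pick where "pick ys = snd (decode (LEAST z. good ys z) :: nat \<times> nat)" for ys
  have ex_good: "\<exists>z. good ys z" for ys
  proof -
    have "\<not> (\<Union>s. set (L (h' (length ys)) s)) \<subseteq> set ys"
      using inf finite_subset by blast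
    then obtain s y where "y \<in> set (L (h' (length ys)) s)" "y \<notin> set ys" by blast
    then have "good ys (encode (s, y))" by (simp add: good_def)
    then show ?thesis by blast
  qed
  have good: "good ys (LEAST z. good ys z)" for ys
    by (rule LeastI_ex) (rule ex_good)
  have pick: "computable pick"
    unfolding pick_def
  proof (intro computable_intros ex_good)
    show "decidable (\<lambda>p. good (fst p) (snd p))"
      unfolding good_def by (intro computable_intros computable_comp2[OF L] computable_comp[OF h'])
  qed
  define hist where "hist = rec_nat [] (\<lambda>_ ys. ys @ [pick ys])"
  define f where "f n = pick (hist n)" for n
  have hist: "hist n = map f [0..<n]" for n
    by (induction n) (simp_all add: hist_def f_def)
  have "computable f"
    by (rule computable_course_of_values[OF pick]) (simp add: f_def hist)
  moreover have "f n \<in> A \<longleftrightarrow> n \<in> C" for n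
  proof -
    have "f n \<in> A \<longleftrightarrow> h' (length (hist n)) \<in> A"
      using good[of "hist n"] homogeneous unfolding good_def f_def pick_def by blast
    then show ?thesis by (simp add: h'_A hist)
  qed
  moreover have "inj f"
  proof (rule linorder_injI)
    fix m n :: nat assume "m < n"
    have "f n \<notin> set (hist n)"
      using good[of "hist n"] unfolding good_def f_def pick_def by blast
    moreover have "f m \<in> set (hist n)"
      using \<open>m < n\<close> by (simp add: hist)
    ultimately show "f m \<noteq> f n" by auto
  qed
  ultimately show "one_one_reducible C A"
    unfolding one_one_reducible_def one_one_reduction_def many_one_reduction_def
    by (auto simp: computable_nat_iff)
qed

section \<open>The antichain\<close>

lemma total_recursive_id: "total_recursive (\<lambda>x. x)"
  using computable_ident by (simp add: computable_nat_iff[symmetric])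

lemma one_one_reducible_refl: "one_one_reducible A A"
  unfolding one_one_reducible_def one_one_reduction_def many_one_reduction_def
  using total_recursive_id by auto

lemma finite_one_reducible_if_one_one:
  assumes "one_one_reducible A B"
  shows "finite_one_reducible A B"
proof -
  obtain f where f: "many_one_reduction f A B" "inj f"
    using assms unfolding one_one_reducible_def one_one_reduction_def by blast
  have "finite {x. f x = y}" for y
    using finite_vimageI[OF _ f(2), of "{y}"] by (simp add: vimage_def)
  with f(1) show ?thesis
    unfolding finite_one_reducible_def finite_one_reduction_def by blast
qed

theorem theorem2:
  fixes A :: "nat set"
  assumes "infinite A" and "infinite (- A)"
  shows "\<exists>B :: nat \<Rightarrow> nat set.
    (\<forall>k. finite_one_equivalent (B k) A) \<and>
    (\<forall>k. one_one_reducible A (B k)) \<and>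
    ((\<forall>i j. i \<noteq> j \<longrightarrow> \<not> one_one_reducible (B i) (B j)) \<or>
     (in_greatest_one_one_degree A \<and> (\<forall>k. one_one_equivalent (B k) A)))"
proof (cases "in_greatest_one_one_degree A")
  case True
  then show ?thesis
    by (intro exI[of _ "\<lambda>_. A"])
      (simp add: finite_one_equivalent_def one_one_equivalent_def one_one_reducible_refl
        finite_one_reducible_if_one_one)
next
  case False
  define B where "B k = {u. original k u \<in> A}" for k
  have up: "one_one_reducible A (B k)" for k
  proof -
    let ?f = "\<lambda>b :: nat. encode (0 :: nat, b)"
    have "computable ?f" by (intro computable_intros)
    moreover have "inj ?f" by (rule injI) simp
    ultimately show ?thesis
      unfolding one_one_reducible_def one_one_reduction_def many_one_reduction_def
      by (auto simp: computable_nat_iff B_def original_0 intro!: exI[of _ ?f])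
  qed
  have "computable (original k)" for k by (intro computable_intros)
  then have down: "finite_one_reducible (B k) A" for k
    unfolding finite_one_reducible_def finite_one_reduction_def many_one_reduction_def
    by (auto simp: computable_nat_iff B_def finite_copies intro!: exI[of _ "original k"])
  have "\<not> one_one_reducible (B i) (B j)" if "i \<noteq> j" for i j
  proof
    assume "one_one_reducible (B i) (B j)"
    then obtain f p where p: "\<And>x. computes p [x] (f x)" and "inj f"
      and f: "\<And>u. original i u \<in> A \<longleftrightarrow> original j (f u) \<in> A"
      unfolding one_one_reducible_def one_one_reduction_def many_one_reduction_def
        total_recursive_def B_def by auto
    have "in_greatest_one_one_degree A"
    proof (rule greatest_if_infinite_classes[OF _ _ _ assms])
      show "computable (\<lambda>q. reach original (i, j, code p) (fst q) (snd q))"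
        by (intro computable_intros)
      show "y \<in> A \<longleftrightarrow> x \<in> A" if "y \<in> set (reach original (i, j, code p) x s)" for x s y
        using reach_homogeneous[OF p f that] .
      show "finite {x. finite (\<Union>s. set (reach original (i, j, code p) x s))}"
        by (rule finite_reach_exceptional[OF p \<open>inj f\<close> \<open>i \<noteq> j\<close>])
    qed
    with False show False by blast
  qed
  then show ?thesis
    using up down finite_one_reducible_if_one_one unfolding finite_one_equivalent_def
    by (intro exI[of _ B]) blast
qed

end
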